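(* For a given $a\in(0,1]$ there exists $C>0$ such that $$\|Q_tf\|_{L^1(\mathbb T)}\le\frac{C}{(1+t)^a}\int_{\mathbb T}\frac{|f(k)|}{|k|^{2a}}dk,\qquad\forall t\ge0,$$ for all measurable $f:\mathbb T\to\mathbb C$ with $\int_{\mathbb T}|f(k)||k|^{-2a}dk<\infty$ and $\int_{\mathbb T}f\,dk=0$.
   Context: $\mathbb T=[-1/2,1/2]$ with endpoints identified, with Lebesgue measure $dk$. $R(k,k')=8\sin^2(\pi k)\sin^2(\pi k')\{\sin^2[\pi(k+k')]+\sin^2[\pi(k-k')]\}$ and $\mathcal Lf(k)=\int_{\mathbb T}R(k,k')[f(k')-f(k)]dk'$, the generator of a Markov jump process on $\mathbb T$; $\{Q_t\}_{t\ge0}$ is the semigroup generated by $\mathcal L$ (a contraction on each $L^p(\mathbb T)$, $p\in[1,\infty]$). *)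

theory Defs
  imports "HOL-Analysis.Analysis"
begin

text \<open>The torus T = [-1/2,1/2] (endpoints identified) with Lebesgue measure.
  Identifying the endpoints does not affect the measure; |k| is the distance to 0.\<close>
definition torus :: "real measure" where
  "torus = lebesgue_on {-1/2..1/2}"

definition Rker :: "real \<Rightarrow> real \<Rightarrow> real" where
  "Rker k k' = 8 * (sin (pi * k))\<^sup>2 * (sin (pi * k'))\<^sup>2 *
     ((sin (pi * (k + k')))\<^sup>2 + (sin (pi * (k - k')))\<^sup>2)"

definition gen :: "(real \<Rightarrow> complex) \<Rightarrow> real \<Rightarrow> complex" where
  "gen f k = (LINT k'|torus. complex_of_real (Rker k k') * (f k' - f k))"

text \<open>L is a bounded operator (R is bounded), so the semigroup is Q_t = exp(t L),
  given by the exponential series.\<close>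
definition Qsg :: "real \<Rightarrow> (real \<Rightarrow> complex) \<Rightarrow> real \<Rightarrow> complex" where
  "Qsg t f k = (\<Sum>n. complex_of_real (t ^ n / fact n) * (gen ^^ n) f k)"

end

theory Submission
  imports Defs
begin

text \<open>
  Writing \<open>p = sin\<^sup>4 (\<pi> k)\<close> and \<open>q = sin\<^sup>2 (\<pi> k) cos\<^sup>2 (\<pi> k)\<close>, the kernel is
  \<open>R(k,k') = 16 (p(k) q(k') + q(k) p(k'))\<close>, so the generator is \<open>16 (P - I)\<close> for the
  \<open>L\<^sup>1\<close>-contraction \<open>P u = (1 - r) u + p \<langle>q,u\<rangle> + q \<langle>p,u\<rangle>\<close> with \<open>r = p/8 + 3q/8\<close>, and
  \<open>Q\<^sub>t\<close> is the average of the powers \<open>P\<^sup>n\<close> over a Poisson variable of mean \<open>16 t\<close>.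

  For a mean-zero \<open>u = O(r)\<close> the functional \<open>\<integral> |u| W/r + M \<parallel>u\<parallel>\<^sub>1\<close>, \<open>W = |k|\<^sup>-\<^sup>1\<^sup>/\<^sup>2\<close>, loses at least
  \<open>\<parallel>u\<parallel>\<^sub>1\<close> at each step: if much mass of \<open>u\<close> sits near \<open>0\<close>, where \<open>W\<close> is large, the first term
  drops, and otherwise the positive and negative parts cancel through \<open>\<langle>p,u\<rangle>\<close>. Hence
  \<open>\<Sum>\<^sub>n \<parallel>P\<^sup>n u\<parallel>\<^sub>1 < \<infinity>\<close> for such \<open>u\<close>.

  If only \<open>\<integral> |f| k\<^sup>-\<^sup>2 < \<infinity>\<close> and \<open>f\<close> has mean zero, then a Duhamel expansion around multiplication by
  \<open>1 - r\<close> only meets the two profiles \<open>p - 3q\<close> and \<open>8 (q - P q)\<close>, to which the previous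
  step applies; as \<open>\<Sum>\<^sub>n (1 - r)\<^sup>n = 1/r\<close>, this bounds \<open>\<Sum>\<^sub>n \<parallel>P\<^sup>n f\<parallel>\<^sub>1\<close> by \<open>C \<integral> |f| k\<^sup>-\<^sup>2\<close>.
  Since \<open>\<parallel>P\<^sup>n f\<parallel>\<^sub>1\<close> is nonincreasing, it is at most \<open>C/(n+1) \<integral> |f| k\<^sup>-\<^sup>2\<close>, which is the
  case \<open>a = 1\<close>. Cutting \<open>f\<close> at \<open>|k| = (1+t)\<^sup>-\<^sup>1\<^sup>/\<^sup>2\<close> and restoring the means gives all \<open>a\<close>.
\<close>

section \<open>The kernel\<close>

definition pfun :: "real \<Rightarrow> real" where
  "pfun k = sin (pi * k) ^ 4"

definition qfun :: "real \<Rightarrow> real" where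
  "qfun k = (sin (pi * k))\<^sup>2 * (cos (pi * k))\<^sup>2"

definition rate :: "real \<Rightarrow> real" where
  "rate k = pfun k / 8 + 3 * qfun k / 8"

text \<open>The addition formulas cancel the mixed products, leaving a kernel of rank two. This is
  why the nonlocal part of the generator reduces to two scalar products.\<close>

lemma Rker_eq: "Rker k k' = 16 * (pfun k * qfun k' + qfun k * pfun k')"
proof -
  have "(sin (pi * (k + k')))\<^sup>2 + (sin (pi * (k - k')))\<^sup>2
     = 2 * ((sin (pi * k))\<^sup>2 * (cos (pi * k'))\<^sup>2 + (cos (pi * k))\<^sup>2 * (sin (pi * k'))\<^sup>2)"
    by (simp add: distrib_left right_diff_distrib sin_add sin_diff power2_eq_square algebra_simps)
  then show ?thesis
    unfolding Rker_def pfun_def qfun_def by (simp add: power2_eq_square power4_eq_xxxx algebra_simps)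
qed

lemma pq_nonneg: "0 \<le> pfun k" "0 \<le> qfun k"
  by (auto simp: pfun_def qfun_def)

lemma pq_sum: "pfun k + qfun k = (sin (pi * k))\<^sup>2"
proof -
  have "pfun k + qfun k = (sin (pi * k))\<^sup>2 * ((sin (pi * k))\<^sup>2 + (cos (pi * k))\<^sup>2)"
    unfolding pfun_def qfun_def by (simp only: power2_eq_square power4_eq_xxxx distrib_left mult.assoc)
  then show ?thesis by simp
qed

lemma pq_sum_le: "pfun k + qfun k \<le> 1"
  using pq_sum[of k] sin_squared_eq[of "pi * k"] by simp

lemma pq_le: "pfun k \<le> 1" "qfun k \<le> 1"
  using pq_sum_le[of k] pq_nonneg[of k] by auto

lemma rate_nonneg: "0 \<le> rate k"
  using pq_nonneg[of k] by (simp add: rate_def)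

lemma rate_le: "rate k \<le> 1/2"
  using pq_sum_le[of k] pq_nonneg[of k] by (simp add: rate_def)

lemma pq_le_rate: "pfun k + qfun k \<le> 8 * rate k"
  using pq_nonneg[of k] by (simp add: rate_def)

section \<open>Pointwise bounds on the profiles in powers of k\<close>

lemma abs_le_abs_sin_pi:
  assumes "\<bar>k\<bar> \<le> 1/2"
  shows "\<bar>k\<bar> \<le> \<bar>sin (pi * k)\<bar>"
proof -
  \<comment> \<open>The half angle lies in \<open>[0, pi/4]\<close>, where the square of
    \<open>cos y\<close> is at least 1/2. With \<open>y * cos y \<le> sin y\<close>, the double
    angle formula then gives \<open>y \<le> sin (2 * y)\<close>, while \<open>pi \<ge> 2\<close>
    gives \<open>\<bar>k\<bar> \<le> y\<close>.\<close>
  define y where "y = pi * \<bar>k\<bar> / 2"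
  have y: "0 \<le> y" "y \<le> pi / 4" using assms by (auto simp: y_def)
  have c: "cos y \<ge> sqrt 2 / 2"
    using cos_monotone_0_pi_le[of y "pi/4"] y pi_gt_zero by (simp add: cos_45)
  have cpos: "0 < cos y" by (rule less_le_trans[OF _ c]) simp
  have c2: "1/2 \<le> (cos y)\<^sup>2"
    using power_mono[OF c, of 2] by (simp add: power_divide)
  have ge: "y * cos y \<le> sin y"
  proof -
    have d: "((\<lambda>x. sin x - x * cos x) has_real_derivative (x * sin x)) (at x)" for x :: real
      by (auto intro!: derivative_eq_intros simp: algebra_simps)
    have "sin 0 - 0 * cos 0 \<le> sin y - y * cos y"
    proof (rule DERIV_nonneg_imp_nondecreasing[OF y(1)])
      fix x assume "0 \<le> x" "x \<le> y"
      then show "\<exists>z. ((\<lambda>x. sin x - x * cos x) has_real_derivative z) (at x) \<and> 0 \<le> z"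
        using d[of x] y by (intro exI[of _ "x * sin x"]) (auto intro!: mult_nonneg_nonneg sin_ge_zero)
    qed
    then show ?thesis by simp
  qed
  have "\<bar>k\<bar> \<le> y" unfolding y_def using pi_ge_two mult_right_mono[of 2 pi "\<bar>k\<bar>"] by simp
  also have "y \<le> 2 * (y * cos y) * cos y"
    using mult_left_mono[OF c2 y(1)] by (simp add: power2_eq_square)
  also have "\<dots> \<le> 2 * sin y * cos y" using ge cpos by (intro mult_right_mono) auto
  also have "\<dots> = sin (pi * \<bar>k\<bar>)" using sin_double[of y] by (simp add: y_def)
  also have "\<dots> \<le> \<bar>sin (pi * k)\<bar>" by (cases "k \<ge> 0") auto
  finally show ?thesis .
qed

lemma rate_ge:
  assumes "\<bar>k\<bar> \<le> 1/2"
  shows "k\<^sup>2 \<le> 8 * rate k"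
  using power_mono[OF abs_le_abs_sin_pi[OF assms], of 2] pq_sum[of k] pq_le_rate[of k] by simp

lemma pfun_ge:
  assumes "\<bar>k\<bar> \<le> 1/2" "0 \<le> \<delta>" "\<delta> \<le> \<bar>k\<bar>"
  shows "\<delta> ^ 4 \<le> pfun k"
  using power_mono[of \<delta> "\<bar>sin (pi * k)\<bar>" 4] abs_le_abs_sin_pi[OF assms(1)] assms
  by (simp add: pfun_def)

lemma qfun_le_square: "qfun k \<le> 10 * k\<^sup>2"
proof -
  have "\<bar>sin (pi * k)\<bar> \<le> \<bar>pi * k\<bar>" by (rule abs_sin_x_le_abs_x)
  then have "(sin (pi * k))\<^sup>2 \<le> (pi * k)\<^sup>2" by (metis abs_le_square_iff)
  also have "\<dots> \<le> 10 * k\<^sup>2"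
  proof -
    have "pi \<le> 3.15" using pi_approx by simp
    then have "pi\<^sup>2 \<le> 3.15\<^sup>2" using pi_ge_two by (intro power_mono) auto
    then have "pi\<^sup>2 \<le> 10" by (simp add: power2_eq_square)
    then show ?thesis by (simp add: power_mult_distrib mult_right_mono)
  qed
  finally show ?thesis using pq_sum[of k] pq_nonneg[of k] by simp
qed

section \<open>Integration on the torus\<close>

lemma space_torus: "space torus = {-1/2..1/2}"
  by (simp add: torus_def)


lemma emeasure_torus: "emeasure torus (space torus) = 1"
  by (simp add: torus_def emeasure_restrict_space)

interpretation torus: finite_measure torus
  by standard (simp add: emeasure_torus)

lemma measure_torus: "measure torus (space torus) = 1"
  using emeasure_torus by (simp add: measure_def)

lemma measurable_torus: "g \<in> borel_measurable borel \<Longrightarrow> g \<in> borel_measurable torus"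
  unfolding torus_def by (simp add: borel_measurable_if_I measurable_completion measurable_restrict_space1)

lemma pqr_measurable [measurable]:
  "pfun \<in> borel_measurable torus" "qfun \<in> borel_measurable torus" "rate \<in> borel_measurable torus"
  "(\<lambda>k. k) \<in> borel_measurable torus"
  unfolding pfun_def[abs_def] qfun_def[abs_def] rate_def[abs_def]
  by (rule measurable_torus, measurable)+

lemma integrable_bounded_mult:
  fixes u :: "real \<Rightarrow> real"
  assumes "integrable torus u" and [measurable]: "g \<in> borel_measurable torus"
    and "\<And>k. \<bar>g k\<bar> \<le> B"
  shows "integrable torus (\<lambda>k. g k * u k)"
proof (rule Bochner_Integration.integrable_bound)
  show "integrable torus (\<lambda>k. B * u k)" using assms(1) by simp
  show "(\<lambda>k. g k * u k) \<in> borel_measurable torus" using assms by measurable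
  show "AE k in torus. norm (g k * u k) \<le> norm (B * u k)"
    using order_trans[OF assms(3) abs_ge_self]
    by (intro AE_I2) (simp add: abs_mult mult_right_mono)
qed

lemma integrable_pqr [simp]:
  assumes "integrable torus u"
  shows "integrable torus (\<lambda>k. pfun k * u k)" "integrable torus (\<lambda>k. qfun k * u k)"
    "integrable torus (\<lambda>k. rate k * u k)"
  using pq_nonneg pq_le rate_nonneg order_trans[OF rate_le, of 1]
  by (auto intro!: integrable_bounded_mult[where B=1] assms)

lemma integrable_pq [simp]: "integrable torus pfun" "integrable torus qfun" "integrable torus rate"
  using integrable_pqr[of "\<lambda>_. 1"] by auto

lemma LINT_torus_FTC:
  fixes F :: "real \<Rightarrow> real"
  assumes "integrable torus f" "\<And>x. (F has_real_derivative f x) (at x)"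
  shows "(LINT k|torus. f k) = F (1/2) - F (-1/2)"
proof -
  have "(f has_integral (F (1/2) - F (-1/2))) {-1/2..1/2}"
    by (rule fundamental_theorem_of_calculus)
      (use assms(2) in \<open>auto simp: has_real_derivative_iff_has_vector_derivative[symmetric]
        intro: has_field_derivative_at_within\<close>)
  moreover have "integral {-1/2..1/2} f = (LINT k|torus. f k)"
    using assms(1) unfolding torus_def by (intro lebesgue_integral_eq_integral[symmetric]) auto
  ultimately show ?thesis by (simp add: integral_unique)
qed

text \<open>The antiderivatives combine a linear term with \<open>sin * cos\<close> and
  \<open>sin ^ 3 * cos\<close>. The last two vanish at both endpoints, so each integral is the
  coefficient of the linear term.\<close>

lemma integral_pq: "(LINT k|torus. pfun k) = 3/8" "(LINT k|torus. qfun k) = 1/8"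
proof -
  let ?s = "\<lambda>k. sin (pi * k)" and ?c = "\<lambda>k. cos (pi * k)"
  have c2: "(?c k)\<^sup>2 = 1 - (?s k)\<^sup>2" for k by (simp add: cos_squared_eq)
  have a: "((\<lambda>k. ?s k * ?c k) has_real_derivative pi * ((?c k)\<^sup>2 - (?s k)\<^sup>2)) (at k)" for k
    by (auto intro!: derivative_eq_intros simp: power2_eq_square algebra_simps)
  have b: "((\<lambda>k. ?s k ^ 3 * ?c k) has_real_derivative pi * (3 * qfun k - pfun k)) (at k)" for k
    by (auto intro!: derivative_eq_intros
        simp: power2_eq_square power3_eq_cube power4_eq_xxxx pfun_def qfun_def algebra_simps)
  have P: "((\<lambda>k. 3 / 8 * k - 3 / (8 * pi) * (?s k * ?c k) - 1 / (4 * pi) * (?s k ^ 3 * ?c k))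
      has_real_derivative pfun k) (at k)" for k
    by (rule DERIV_cong[OF DERIV_diff[OF DERIV_diff[OF
        DERIV_cmult[OF DERIV_ident] DERIV_cmult[OF a]] DERIV_cmult[OF b]]])
      (use pi_neq_zero in \<open>simp add: c2 field_simps flip: pq_sum\<close>)
  have Q: "((\<lambda>k. 1 / 8 * k - 1 / (8 * pi) * (?s k * ?c k) + 1 / (4 * pi) * (?s k ^ 3 * ?c k))
      has_real_derivative qfun k) (at k)" for k
    by (rule DERIV_cong[OF DERIV_add[OF DERIV_diff[OF
        DERIV_cmult[OF DERIV_ident] DERIV_cmult[OF a]] DERIV_cmult[OF b]]])
      (use pi_neq_zero in \<open>simp add: c2 field_simps flip: pq_sum\<close>)
  show "(LINT k|torus. pfun k) = 3/8" using LINT_torus_FTC[OF _ P] by simp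
  show "(LINT k|torus. qfun k) = 1/8" using LINT_torus_FTC[OF _ Q] by simp
qed

text \<open>The exponent lies strictly between -1 and 0, so the weight is integrable and yet blows
  up at 0; the Lyapunov argument uses both properties. At 0 itself \<open>powr\<close> returns
  0.\<close>

definition wt :: "real \<Rightarrow> real" where "wt k = \<bar>k\<bar> powr (-1/2)"

lemma integrable_wt: "integrable torus wt"
proof -
  have 1: "wt integrable_on {0..1/2}"
    using integrable_on_powr_from_0[of "-1/2" "1/2"]
    by (rule integrable_spike[where S="{}"]) (auto simp: wt_def)
  then have "(\<lambda>x. wt (- x)) integrable_on {-(1/2)..-0}"
    by (subst Henstock_Kurzweil_Integration.integrable_reflect_real)
  then have 2: "wt integrable_on {-1/2..0}" by (simp add: wt_def[abs_def])
  have "wt integrable_on {-1/2..1/2}"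
    by (rule Henstock_Kurzweil_Integration.integrable_combine[OF _ _ 2 1]) auto
  then have "wt absolutely_integrable_on {-1/2..1/2}"
    by (rule nonnegative_absolutely_integrable_1) (simp add: wt_def)
  then show ?thesis
    unfolding torus_def by (subst integrable_restrict_space) (auto simp: set_integrable_def)
qed

section \<open>The discrete Markov operator\<close>

definition ip :: "(real \<Rightarrow> real) \<Rightarrow> (real \<Rightarrow> real) \<Rightarrow> real" where
  "ip g u = (LINT k|torus. g k * u k)"

definition L1 :: "(real \<Rightarrow> real) \<Rightarrow> real" where
  "L1 u = (LINT k|torus. \<bar>u k\<bar>)"

definition WL1 :: "(real \<Rightarrow> real) \<Rightarrow> (real \<Rightarrow> real) \<Rightarrow> real" where
  "WL1 w u = (LINT k|torus. w k * \<bar>u k\<bar>)"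

text \<open>Uniformization: the jump rate at \<open>k\<close> is \<open>16 * rate k\<close>, below
  16, so a clock of rate 16 that leaves the particle in place with probability
  \<open>1 - rate k\<close> drives this chain. It acts here on densities.\<close>

definition markov :: "(real \<Rightarrow> real) \<Rightarrow> real \<Rightarrow> real" where
  "markov u k = (1 - rate k) * u k + (pfun k * ip qfun u + qfun k * ip pfun u)"

lemma WL1_eq: "WL1 w u = ip w (\<lambda>k. \<bar>u k\<bar>)"
  by (simp add: WL1_def ip_def)

lemma abs_loss: "\<bar>(1 - rate k) * x\<bar> = \<bar>x\<bar> - rate k * \<bar>x\<bar>"
  using rate_le[of k] by (simp only: abs_mult) (simp add: left_diff_distrib)

lemma L1_nonneg: "0 \<le> L1 u"
  by (simp add: L1_def)

lemma ip_rate: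
  assumes "integrable torus u"
  shows "ip rate u = ip pfun u / 8 + 3 * ip qfun u / 8"
proof -
  have "ip rate u = (LINT k|torus. 1/8 * (pfun k * u k) + 3/8 * (qfun k * u k))"
    unfolding ip_def rate_def by (simp add: algebra_simps)
  then show ?thesis using assms by (simp add: ip_def)
qed

lemma abs_ip_le:
  assumes "integrable torus u" "\<And>k. 0 \<le> g k" and [measurable]: "g \<in> borel_measurable torus"
    and "\<And>k. g k \<le> 1"
  shows "\<bar>ip g u\<bar> \<le> WL1 g u" "WL1 g u \<le> L1 u"
proof -
  have i: "integrable torus (\<lambda>k. g k * \<bar>u k\<bar>)"
    using assms by (intro integrable_bounded_mult[where B=1]) auto
  show "\<bar>ip g u\<bar> \<le> WL1 g u"
    unfolding ip_def WL1_def using integral_abs_bound[of torus "\<lambda>k. g k * u k"] assms(2)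
    by (simp add: abs_mult)
  show "WL1 g u \<le> L1 u"
    unfolding WL1_def L1_def using assms
    by (intro integral_mono i) (auto simp: mult_left_le_one_le)
qed

lemma abs_ip_p_le:
  assumes "integrable torus u"
  shows "\<bar>ip pfun u\<bar> \<le> WL1 pfun u" "WL1 pfun u \<le> L1 u"
  by (rule abs_ip_le[OF assms]; auto simp: pq_nonneg pq_le)+

lemma abs_ip_q_le:
  assumes "integrable torus u"
  shows "\<bar>ip qfun u\<bar> \<le> WL1 qfun u" "WL1 qfun u \<le> L1 u"
  by (rule abs_ip_le[OF assms]; auto simp: pq_nonneg pq_le)+

lemma markov_integrable [simp]: "integrable torus u \<Longrightarrow> integrable torus (markov u)"
  unfolding markov_def[abs_def] left_diff_distrib by simp

lemma markov_pow_integrable [simp]: "integrable torus u \<Longrightarrow> integrable torus ((markov ^^ n) u)"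
  by (induction n) auto

text \<open>Mass balance: the coefficients 1/8 and 3/8 in \<open>rate\<close> are the integrals of
  \<open>qfun\<close> and \<open>pfun\<close>, so the integrated gain equals the loss
  \<open>ip rate u\<close>.\<close>

lemma integral_markov:
  assumes "integrable torus u"
  shows "(LINT k|torus. markov u k) = (LINT k|torus. u k)"
proof -
  have "(LINT k|torus. markov u k) = (LINT k|torus. u k) - ip rate u + (3/8 * ip qfun u + 1/8 * ip pfun u)"
    using assms unfolding markov_def left_diff_distrib ip_def by (simp add: integral_pq)
  then show ?thesis using ip_rate[OF assms] by simp
qed

lemma abs_markov_le:
  "\<bar>markov u k\<bar> \<le> (\<bar>u k\<bar> - rate k * \<bar>u k\<bar>) + (pfun k * \<bar>ip qfun u\<bar> + qfun k * \<bar>ip pfun u\<bar>)"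
proof -
  have "\<bar>markov u k\<bar> \<le> \<bar>(1 - rate k) * u k\<bar> + (\<bar>pfun k * ip qfun u\<bar> + \<bar>qfun k * ip pfun u\<bar>)"
    unfolding markov_def by linarith
  also have "\<dots> = (\<bar>u k\<bar> - rate k * \<bar>u k\<bar>) + (pfun k * \<bar>ip qfun u\<bar> + qfun k * \<bar>ip pfun u\<bar>)"
    using pq_nonneg[of k] unfolding abs_loss by (simp add: abs_mult)
  finally show ?thesis .
qed

text \<open>The gain term is coarser than in \<open>abs_markov_le\<close> but proportional to
  \<open>rate\<close>. This preserves \<open>O(rate)\<close> bounds under iteration and produces
  \<open>wt\<close> after multiplication by \<open>lyap\<close>.\<close>

lemma abs_markov_le_L1:
  assumes "integrable torus u"
  shows "\<bar>markov u k\<bar> \<le> (\<bar>u k\<bar> - rate k * \<bar>u k\<bar>) + 8 * L1 u * rate k"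
proof -
  have "pfun k * \<bar>ip qfun u\<bar> + qfun k * \<bar>ip pfun u\<bar> \<le> (pfun k + qfun k) * L1 u"
    using abs_ip_p_le[OF assms] abs_ip_q_le[OF assms] pq_nonneg[of k]
    by (simp add: distrib_right add_mono mult_left_mono)
  also have "\<dots> \<le> 8 * rate k * L1 u"
    by (intro mult_right_mono pq_le_rate L1_nonneg)
  finally show ?thesis using abs_markov_le[of u k] by (simp add: mult_ac)
qed

text \<open>After integration, loss and gain balance except for the cancellation of signs inside the
  two scalar products. The cancellation in \<open>ip qfun u\<close> is discarded; that in
  \<open>ip pfun u\<close> enters with weight 1/8, the integral of \<open>qfun\<close>.\<close>

lemma L1_markov_strict:
  assumes u: "integrable torus u"
  shows "WL1 pfun u - \<bar>ip pfun u\<bar> \<le> 8 * (L1 u - L1 (markov u))"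
proof -
  have "L1 (markov u) \<le>
    (LINT k|torus. (\<bar>u k\<bar> - rate k * \<bar>u k\<bar>) + (pfun k * \<bar>ip qfun u\<bar> + qfun k * \<bar>ip pfun u\<bar>))"
    unfolding L1_def
  proof (rule integral_mono)
    show "\<bar>markov u k\<bar> \<le> (\<bar>u k\<bar> - rate k * \<bar>u k\<bar>) + (pfun k * \<bar>ip qfun u\<bar> + qfun k * \<bar>ip pfun u\<bar>)" for k
      by (rule abs_markov_le)
  qed (use u in auto)
  also have "\<dots> = L1 u - WL1 rate u + (3/8 * \<bar>ip qfun u\<bar> + 1/8 * \<bar>ip pfun u\<bar>)"
    using u by (simp add: integral_pq L1_def WL1_def)
  finally have "L1 (markov u) \<le> L1 u - WL1 rate u + (3/8 * \<bar>ip qfun u\<bar> + 1/8 * \<bar>ip pfun u\<bar>)" .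
  moreover have "WL1 rate u = WL1 pfun u / 8 + 3 * WL1 qfun u / 8"
    using ip_rate[of "\<lambda>k. \<bar>u k\<bar>"] u by (simp add: WL1_eq)
  ultimately show ?thesis using abs_ip_q_le(1)[OF u] by argo
qed

lemma L1_markov_le:
  assumes "integrable torus u"
  shows "L1 (markov u) \<le> L1 u"
  using L1_markov_strict[OF assms] abs_ip_p_le(1)[OF assms] by argo

lemma L1_markov_pow_antimono:
  assumes "integrable torus u" "m \<le> n"
  shows "L1 ((markov ^^ n) u) \<le> L1 ((markov ^^ m) u)"
  using lift_Suc_antimono_le[of "\<lambda>n. L1 ((markov ^^ n) u)", OF _ \<open>m \<le> n\<close>]
    L1_markov_le[OF markov_pow_integrable[OF assms(1)]] by simp

section \<open>Linearity of the powers and the triangle inequality\<close>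

lemma ip_lincomb:
  assumes "integrable torus u" "integrable torus v" "g \<in> {pfun, qfun}"
  shows "ip g (\<lambda>k. a * u k + b * v k) = a * ip g u + b * ip g v"
proof -
  have "ip g (\<lambda>k. a * u k + b * v k) = (LINT k|torus. a * (g k * u k) + b * (g k * v k))"
    unfolding ip_def by (simp add: algebra_simps)
  then show ?thesis using assms unfolding ip_def by auto
qed

lemma markov_lincomb:
  assumes "integrable torus u" "integrable torus v"
  shows "markov (\<lambda>k. a * u k + b * v k) = (\<lambda>k. a * markov u k + b * markov v k)"
  using ip_lincomb[OF assms] unfolding markov_def by (simp add: algebra_simps)

lemma markov_pow_lincomb:
  assumes "integrable torus u" "integrable torus v"
  shows "(markov ^^ n) (\<lambda>k. a * u k + b * v k) = (\<lambda>k. a * (markov ^^ n) u k + b * (markov ^^ n) v k)"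
  using assms by (induction n) (auto simp: markov_lincomb)

lemma L1_triangle:
  assumes "integrable torus u" "integrable torus v"
  shows "L1 (\<lambda>k. a * u k + b * v k) \<le> \<bar>a\<bar> * L1 u + \<bar>b\<bar> * L1 v"
proof -
  have "L1 (\<lambda>k. a * u k + b * v k) \<le> (LINT k|torus. \<bar>a\<bar> * \<bar>u k\<bar> + \<bar>b\<bar> * \<bar>v k\<bar>)"
    unfolding L1_def using assms
    by (intro integral_mono) (auto intro: order_trans[OF abs_triangle_ineq] simp: abs_mult)
  then show ?thesis using assms by (simp add: L1_def)
qed

lemma L1_markov_pow_lincomb_le:
  assumes "integrable torus u" "integrable torus v"
  shows "L1 ((markov ^^ n) (\<lambda>k. a * u k + b * v k))
    \<le> \<bar>a\<bar> * L1 ((markov ^^ n) u) + \<bar>b\<bar> * L1 ((markov ^^ n) v)"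
  using assms by (simp add: markov_pow_lincomb L1_triangle)

section \<open>Lyapunov functional\<close>

lemma integrable_rate_bound:
  fixes u :: "real \<Rightarrow> real"
  assumes "u \<in> borel_measurable torus" "\<And>k. \<bar>u k\<bar> \<le> C * rate k"
  shows "integrable torus u"
  by (rule Bochner_Integration.integrable_bound[where f="\<lambda>k. C * rate k"])
    (use assms order_trans[OF assms(2) abs_ge_self] in auto)

text \<open>The loss term only decreases \<open>\<bar>u k\<bar>\<close>, and the gain is at most
  \<open>8 * L1 u * rate k\<close>. The constant may grow along iterates; later only its finiteness
  matters.\<close>

lemma markov_rate_bound:
  assumes "u \<in> borel_measurable torus" "\<And>k. \<bar>u k\<bar> \<le> C * rate k"
  shows "\<bar>markov u k\<bar> \<le> (C + 8 * L1 u) * rate k"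
proof -
  note u = integrable_rate_bound[OF assms]
  have "0 \<le> rate k * \<bar>u k\<bar>" by (simp add: rate_nonneg)
  then show ?thesis using abs_markov_le_L1[OF u, of k] assms(2)[of k] unfolding distrib_right by linarith
qed

text \<open>The junk value \<open>lyap 0 = 0\<close> is harmless: \<open>rate\<close> and \<open>wt\<close> both vanish at \<open>0\<close>.\<close>

definition lyap :: "real \<Rightarrow> real" where "lyap k = wt k / rate k"

lemma wt_nonneg: "0 \<le> wt k" by (simp add: wt_def)

lemma lyap_nonneg: "0 \<le> lyap k"
  by (simp add: lyap_def wt_nonneg rate_nonneg)

lemma measurable_wt [measurable]: "wt \<in> borel_measurable torus"
  using integrable_wt by auto

lemma measurable_lyap [measurable]: "lyap \<in> borel_measurable torus"
  unfolding lyap_def[abs_def] by measurable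

lemma rate_lyap: "k \<in> space torus \<Longrightarrow> rate k * lyap k = wt k"
proof -
  assume "k \<in> space torus"
  then have "k\<^sup>2 \<le> 8 * rate k" by (intro rate_ge) (auto simp: space_torus)
  then have "rate k = 0 \<Longrightarrow> k = 0" by simp
  then show ?thesis by (auto simp: lyap_def wt_def)
qed

lemma integrable_lyap:
  assumes [measurable]: "u \<in> borel_measurable torus" and "\<And>k. \<bar>u k\<bar> \<le> C * rate k"
  shows "integrable torus (\<lambda>k. lyap k * \<bar>u k\<bar>)"
proof (rule Bochner_Integration.integrable_bound[where f="\<lambda>k. C * wt k"])
  show "integrable torus (\<lambda>k. C * wt k)" using integrable_wt by simp
  show "AE k in torus. norm (lyap k * \<bar>u k\<bar>) \<le> norm (C * wt k)"
  proof (rule AE_I2)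
    fix k assume "k \<in> space torus"
    then have "lyap k * \<bar>u k\<bar> \<le> C * wt k"
      using mult_left_mono[OF assms(2)[of k] lyap_nonneg[of k]] rate_lyap[of k]
      by (simp add: algebra_simps)
    from order_trans[OF this abs_ge_self] show "norm (lyap k * \<bar>u k\<bar>) \<le> norm (C * wt k)"
      by (simp add: abs_mult lyap_nonneg)
  qed
qed measurable

text \<open>Since \<open>rate * lyap = wt\<close> on the torus, weighting the pointwise bound by
  \<open>lyap\<close> turns the loss into \<open>wt * \<bar>u\<bar>\<close> and the gain into a
  multiple of \<open>wt\<close>, which is integrable.\<close>

lemma wt_drift:
  assumes [measurable]: "u \<in> borel_measurable torus" and ub: "\<And>k. \<bar>u k\<bar> \<le> C * rate k"
  shows "WL1 lyap (markov u)
    \<le> WL1 lyap u - WL1 wt u + 8 * L1 wt * L1 u"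
    and "integrable torus (\<lambda>k. wt k * \<bar>u k\<bar>)"
proof -
  note u = integrable_rate_bound[OF assms]
  have mu [measurable]: "markov u \<in> borel_measurable torus" using u by (auto dest: markov_integrable)
  have iw: "integrable torus (\<lambda>k. rate k * (lyap k * \<bar>u k\<bar>))"
    using integrable_lyap[OF assms] by simp
  have eq: "rate k * (lyap k * \<bar>u k\<bar>) = wt k * \<bar>u k\<bar>" if "k \<in> space torus" for k
    using rate_lyap[OF that] by (simp flip: mult.assoc)
  show iw': "integrable torus (\<lambda>k. wt k * \<bar>u k\<bar>)"
    using iw eq by (subst (asm) Bochner_Integration.integrable_cong[OF refl eq]) auto
  have L1wt: "L1 wt = (LINT k|torus. wt k)" by (simp add: L1_def wt_nonneg)
  have "WL1 lyap (markov u)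
    \<le> (LINT k|torus. lyap k * \<bar>u k\<bar> - wt k * \<bar>u k\<bar> + 8 * L1 u * wt k)"
    unfolding WL1_def
  proof (rule integral_mono)
    show "integrable torus (\<lambda>k. lyap k * \<bar>markov u k\<bar>)"
      by (rule integrable_lyap[OF mu markov_rate_bound[OF assms]])
    show "integrable torus (\<lambda>k. lyap k * \<bar>u k\<bar> - wt k * \<bar>u k\<bar> + 8 * L1 u * wt k)"
      using integrable_lyap[OF assms] iw' integrable_wt by auto
    fix k assume k: "k \<in> space torus"
    have "lyap k * \<bar>markov u k\<bar> \<le> lyap k * ((\<bar>u k\<bar> - rate k * \<bar>u k\<bar>) + 8 * L1 u * rate k)"
      by (rule mult_left_mono[OF abs_markov_le_L1[OF u] lyap_nonneg])
    also have "\<dots> = lyap k * \<bar>u k\<bar> - (rate k * lyap k) * \<bar>u k\<bar> + 8 * L1 u * (rate k * lyap k)"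
      by (simp add: algebra_simps)
    finally show "lyap k * \<bar>markov u k\<bar> \<le> lyap k * \<bar>u k\<bar> - wt k * \<bar>u k\<bar> + 8 * L1 u * wt k"
      by (simp only: rate_lyap[OF k])
  qed
  also have "\<dots> = WL1 lyap u - WL1 wt u + 8 * L1 wt * L1 u"
    using integrable_lyap[OF assms] iw' integrable_wt by (simp add: L1wt WL1_def)
  finally show "WL1 lyap (markov u) \<le> \<dots>" .
qed

text \<open>For both signs \<open>s\<close>, the integrand \<open>p (|u| - s u)\<close> is nonnegative and, away from \<open>0\<close>, at least
  \<open>\<delta>\<^sup>4 (|u| - s u)\<close>, whose total integral is \<open>\<parallel>u\<parallel>\<^sub>1\<close> because \<open>u\<close> has mean zero.\<close>

lemma ip_p_gain:
  assumes u: "integrable torus u" and mean: "(LINT k|torus. u k) = 0" and "0 \<le> \<delta>"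
  shows "\<delta> ^ 4 * (L1 u - 2 * WL1 (indicator {-\<delta><..<\<delta>}) u)
    \<le> WL1 pfun u - \<bar>ip pfun u\<bar>"
proof -
  define I where "I = (\<lambda>k. indicator {-\<delta><..<\<delta>} k :: real)"
  have I [measurable]: "I \<in> borel_measurable torus"
    unfolding I_def by (rule measurable_torus) measurable
  have iI: "integrable torus (\<lambda>k. I k * \<bar>u k\<bar>)"
    using u by (intro integrable_bounded_mult[where B=1]) (auto simp: I_def indicator_def)
  have key: "\<delta> ^ 4 * (L1 u - 2 * WL1 I u) \<le> WL1 pfun u - s * ip pfun u"
    if s: "s = 1 \<or> s = -1" for s :: real
  proof -
    have "\<delta> ^ 4 * (L1 u - 2 * WL1 I u)
      = (LINT k|torus. \<delta> ^ 4 * (\<bar>u k\<bar> - s * u k - 2 * (I k * \<bar>u k\<bar>)))"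
      using u iI mean by (simp add: L1_def WL1_def)
    also have "\<dots> \<le> (LINT k|torus. pfun k * \<bar>u k\<bar> - s * (pfun k * u k))"
    proof (rule integral_mono)
      fix k assume k: "k \<in> space torus"
      have nn: "0 \<le> \<bar>u k\<bar> - s * u k" using s by auto
      show "\<delta> ^ 4 * (\<bar>u k\<bar> - s * u k - 2 * (I k * \<bar>u k\<bar>)) \<le> pfun k * \<bar>u k\<bar> - s * (pfun k * u k)"
      proof (cases "\<bar>k\<bar> < \<delta>")
        \<comment> \<open>Near 0 the term \<open>2 * \<bar>u k\<bar>\<close> is at least
          \<open>\<bar>u k\<bar> - s * u k\<close>, which makes the left side nonpositive.\<close>
        case True
        then have "I k = 1" by (auto simp: I_def indicator_def)
        then have "\<delta> ^ 4 * (\<bar>u k\<bar> - s * u k - 2 * (I k * \<bar>u k\<bar>)) \<le> 0"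
          using s \<open>0 \<le> \<delta>\<close> by (intro mult_nonneg_nonpos) auto
        also have "0 \<le> pfun k * (\<bar>u k\<bar> - s * u k)" by (intro mult_nonneg_nonneg nn pq_nonneg)
        finally show ?thesis by (simp add: algebra_simps)
      next
        case False
        then have "I k = 0" by (auto simp: I_def indicator_def)
        moreover have "\<delta> ^ 4 * (\<bar>u k\<bar> - s * u k) \<le> pfun k * (\<bar>u k\<bar> - s * u k)"
          using False k \<open>0 \<le> \<delta>\<close> by (intro mult_right_mono nn pfun_ge) (auto simp: space_torus)
        ultimately show ?thesis by (simp add: algebra_simps)
      qed
    qed (use u iI in auto)
    also have "\<dots> = WL1 pfun u - s * ip pfun u"
      using u by (simp add: ip_def WL1_def)
    finally show ?thesis .
  qed
  show ?thesis using key[of 1] key[of "-1"] by (simp add: I_def[symmetric])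
qed

text \<open>The source term of \<open>wt_drift\<close> is paid for in two ways: mass within
  \<open>\<delta>\<close> of 0 by the large weight there, the remaining mass by the strict L1 loss,
  which \<open>M\<close> amplifies. \<open>M\<close> is fixed before \<open>u\<close> and
  \<open>C\<close>, so one functional serves all iterates.\<close>

lemma lyapunov_decrease:
  "\<exists>M\<ge>0. \<forall>u C. u \<in> borel_measurable torus \<longrightarrow> (\<forall>k. \<bar>u k\<bar> \<le> C * rate k) \<longrightarrow> (LINT k|torus. u k) = 0 \<longrightarrow>
      WL1 lyap (markov u) + M * L1 (markov u) + L1 u \<le> WL1 lyap u + M * L1 u"
proof -
  \<comment> \<open>\<open>8 * L1 wt\<close> is the coefficient of the source term in the drift; the
    extra 1 leaves the \<open>L1 u\<close> to be gained.\<close>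
  define B where "B = 8 * L1 wt + 1"
  have B: "B \<ge> 1" using L1_nonneg by (simp add: B_def)
  \<comment> \<open>This inverts \<open>wt\<close>: the weight equals \<open>2 * B\<close> at
    distance \<open>\<delta>\<close> from 0 and is larger nearer to 0, except at 0 itself.\<close>
  define \<delta> where "\<delta> = (2 * B) powr (-2)"
  have d: "\<delta> > 0" using B by (simp add: \<delta>_def)
  \<comment> \<open>The 8 comes from \<open>L1_markov_strict\<close>, the power of
    \<open>\<delta>\<close> from \<open>ip_p_gain\<close>.\<close>
  define M where "M = 8 * B / \<delta> ^ 4"
  have M: "M \<ge> 0" using B d by (simp add: M_def)
  have wd: "2 * B \<le> wt k" if "\<bar>k\<bar> < \<delta>" "k \<noteq> 0" for k
  proof -
    have "2 * B = \<delta> powr (-1/2)"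
      using B by (simp add: \<delta>_def powr_powr)
    also have "\<dots> \<le> \<bar>k\<bar> powr (-1/2)" using that by (intro powr_mono2') auto
    finally show ?thesis by (simp add: wt_def)
  qed
  show ?thesis
  proof (intro exI[of _ M] conjI M allI impI)
    fix u C assume [measurable]: "u \<in> borel_measurable torus" and "\<forall>k. \<bar>u k\<bar> \<le> C * rate k"
      and mean: "(LINT k|torus. u k) = 0"
    then have ub: "\<And>k. \<bar>u k\<bar> \<le> C * rate k" by blast
    have u: "integrable torus u" by (rule integrable_rate_bound[OF _ ub]) measurable
    note drift = wt_drift[OF \<open>u \<in> borel_measurable torus\<close> ub]
    define y where "y = WL1 (indicator {-\<delta><..<\<delta>}) u"
    \<comment> \<open>The lower bound \<open>wd\<close> on the weight fails at 0, where
      \<open>wt\<close> is 0; there the integrands vanish because \<open>u\<close> does.\<close>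
    have u0: "u 0 = 0" using ub[of 0] by (simp add: rate_def pfun_def qfun_def)
    have "2 * B * y = (LINT k|torus. 2 * B * (indicator {-\<delta><..<\<delta>} k * \<bar>u k\<bar>))" by (simp add: y_def WL1_def)
    also have "\<dots> \<le> WL1 wt u"
      unfolding WL1_def
    proof (rule integral_mono)
      have "(\<lambda>k. indicator {-\<delta><..<\<delta>} k :: real) \<in> borel_measurable torus"
        by (rule measurable_torus) measurable
      then show "integrable torus (\<lambda>k. 2 * B * (indicator {-\<delta><..<\<delta>} k * \<bar>u k\<bar>))"
        using u by (intro integrable_mult_right integrable_bounded_mult[where B=1]) (auto simp: indicator_def)
      fix k
      show "2 * B * (indicator {-\<delta><..<\<delta>} k * \<bar>u k\<bar>) \<le> wt k * \<bar>u k\<bar>"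
        using wd[of k] u0 wt_nonneg[of k] by (cases "k = 0") (auto simp: indicator_def intro!: mult_right_mono)
    qed (rule drift(2))
    finally have y: "2 * B * y \<le> WL1 wt u" .
    have "\<delta> ^ 4 * (L1 u - 2 * y) \<le> 8 * (L1 u - L1 (markov u))"
      unfolding y_def using order_trans[OF ip_p_gain[OF u mean] L1_markov_strict[OF u]] d by simp
    then have "L1 u - 2 * y \<le> 8 * (L1 u - L1 (markov u)) / \<delta> ^ 4"
      using d by (simp add: pos_le_divide_eq mult.commute)
    from mult_left_mono[OF this, of B] have "B * (L1 u - 2 * y) \<le> M * (L1 u - L1 (markov u))"
      using B by (simp add: M_def algebra_simps)
    moreover have "B * (L1 u - 2 * y) = 8 * L1 wt * L1 u + L1 u - 2 * B * y"
      by (simp add: B_def algebra_simps)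
    ultimately show "WL1 lyap (markov u) + M * L1 (markov u) + L1 u
        \<le> WL1 lyap u + M * L1 u"
      using drift(1) y unfolding right_diff_distrib by argo
  qed
qed

text \<open>The decrease of the functional telescopes, and its nonnegativity bounds every partial
  sum by its initial value.\<close>

lemma summable_L1_markov_pow:
  assumes "h \<in> borel_measurable torus" "\<And>k. \<bar>h k\<bar> \<le> C * rate k" "(LINT k|torus. h k) = 0"
  shows "summable (\<lambda>n. L1 ((markov ^^ n) h))"
proof -
  obtain M where M: "0 \<le> M" and dec: "\<And>u C. u \<in> borel_measurable torus \<Longrightarrow> (\<And>k. \<bar>u k\<bar> \<le> C * rate k) \<Longrightarrow>
      (LINT k|torus. u k) = 0 \<Longrightarrow>
      WL1 lyap (markov u) + M * L1 (markov u) + L1 u \<le> WL1 lyap u + M * L1 u"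
    using lyapunov_decrease by meson
  define \<Phi> where "\<Phi> u = WL1 lyap u + M * L1 u" for u
  have P0: "0 \<le> \<Phi> u" for u
    unfolding \<Phi>_def WL1_def using M L1_nonneg lyap_nonneg by (intro add_nonneg_nonneg integral_nonneg_AE) auto
  \<comment> \<open>The constant in the \<open>O(rate)\<close> bound may depend on \<open>n\<close>,
    which is harmless because \<open>M\<close> does not depend on it.\<close>
  have inv: "(markov ^^ n) h \<in> borel_measurable torus \<and> (\<exists>C. \<forall>k. \<bar>(markov ^^ n) h k\<bar> \<le> C * rate k)
      \<and> (LINT k|torus. (markov ^^ n) h k) = 0" for n
  proof (induction n)
    case 0 then show ?case using assms by auto
  next
    case (Suc n)
    then obtain C where C: "\<And>k. \<bar>(markov ^^ n) h k\<bar> \<le> C * rate k" by auto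
    have "integrable torus ((markov ^^ n) h)" using Suc C by (intro integrable_rate_bound) auto
    then show ?case using Suc markov_rate_bound[OF _ C]
      by (auto simp: integral_markov intro!: borel_measurable_integrable)
  qed
  have sum_le: "(\<Sum>n<N. L1 ((markov ^^ n) h)) + \<Phi> ((markov ^^ N) h) \<le> \<Phi> h" for N
  proof (induction N)
    case (Suc N)
    obtain C where C: "\<And>k. \<bar>(markov ^^ N) h k\<bar> \<le> C * rate k" using inv[of N] by auto
    show ?case using dec[OF _ C] inv[of N] Suc by (simp add: \<Phi>_def)
  qed simp
  have "(\<Sum>n<N. L1 ((markov ^^ n) h)) \<le> \<Phi> h" for N
    using P0[of "(markov ^^ N) h"] sum_le[of N] by linarith
  then show ?thesis by (intro summableI_nonneg_bounded[where x="\<Phi> h"] L1_nonneg)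
qed

section \<open>Decay of the discrete semigroup\<close>

text \<open>A probability density used to remove means. It vanishes quadratically at 0, so
  subtracting it does not harm integrability against \<open>1 / k^2\<close>; being a multiple of
  \<open>qfun\<close>, it also merges with a gain term of \<open>markov\<close>.\<close>

definition dens :: "real \<Rightarrow> real" where "dens k = 8 * qfun k"

lemma dens_nonneg: "0 \<le> dens k"
  by (simp add: dens_def pq_nonneg)

lemma integrable_dens [simp]: "integrable torus dens"
  unfolding dens_def[abs_def] by simp

lemma integral_dens: "(LINT k|torus. dens k) = 1"
  unfolding dens_def by (simp add: integral_pq)

lemma L1_dens: "L1 dens = 1"
  by (simp add: L1_def dens_nonneg integral_dens)

lemma summable_L1_markov_pow_pq: "summable (\<lambda>n. L1 ((markov ^^ n) (\<lambda>k. pfun k - 3 * qfun k)))"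
proof (rule summable_L1_markov_pow)
  show "\<bar>pfun k - 3 * qfun k\<bar> \<le> 8 * rate k" for k
    using pq_nonneg[of k] by (simp add: rate_def)
qed (auto simp: integral_pq)

lemma summable_L1_markov_pow_dens: "summable (\<lambda>n. L1 ((markov ^^ n) (\<lambda>k. dens k - markov dens k)))"
proof (rule summable_L1_markov_pow)
  have d: "\<bar>dens k\<bar> \<le> 64 * rate k" for k
    using pq_le_rate[of k] pq_nonneg[of k] by (simp add: dens_def)
  have m: "\<bar>markov dens k\<bar> \<le> (64 + 8) * rate k" for k
    using markov_rate_bound[OF _ d] by (simp add: L1_dens borel_measurable_integrable)
  show "\<bar>dens k - markov dens k\<bar> \<le> 136 * rate k" for k
    using abs_triangle_ineq4[of "dens k" "markov dens k"] d[of k] m[of k] by simp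
qed (auto simp: integral_markov intro!: borel_measurable_integrable)

text \<open>The part of the mass that has not jumped during \<open>j\<close> steps.\<close>

definition damp :: "nat \<Rightarrow> (real \<Rightarrow> real) \<Rightarrow> real \<Rightarrow> real" where
  "damp j f k = (1 - rate k) ^ j * f k"

lemma integrable_damp [simp]: "integrable torus f \<Longrightarrow> integrable torus (damp j f)"
  unfolding damp_def[abs_def] using rate_nonneg order_trans[OF rate_le, of 1]
  by (intro integrable_bounded_mult[where B=1]) (auto simp: power_le_one)

definition damp_centred :: "nat \<Rightarrow> (real \<Rightarrow> real) \<Rightarrow> real \<Rightarrow> real" where
  "damp_centred j f k = damp j f k - (LINT x|torus. damp j f x) * dens k"

lemma integrable_damp_centred [simp]: "integrable torus f \<Longrightarrow> integrable torus (damp_centred j f)"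
  unfolding damp_centred_def[abs_def] by simp

text \<open>The mass lost from \<open>j\<close> to \<open>Suc j\<close> is
  \<open>ip rate (damp j f)\<close>, which expresses \<open>ip pfun\<close> through
  \<open>ip qfun\<close> and the mass difference. As \<open>dens\<close> is \<open>8 * qfun\<close>,
  the mass difference recentres the damped part, and only two fixed mean-zero profiles remain as
  sources.\<close>

lemma markov_damp_centred:
  assumes f: "integrable torus f"
  shows "markov (damp_centred j f) k = damp_centred (Suc j) f k
    + ip qfun (damp j f) * (pfun k - 3 * qfun k)
    + (LINT x|torus. damp j f x) * (dens k - markov dens k)"
proof -
  let ?F = "\<lambda>j. LINT x|torus. damp j f x"
  have eq: "damp_centred j f = (\<lambda>k. 1 * damp j f k + (- ?F j) * dens k)"
    by (simp add: damp_centred_def[abs_def])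
  have m: "markov (damp_centred j f) k = markov (damp j f) k - ?F j * markov dens k"
    unfolding eq using f by (subst markov_lincomb) auto
  have "damp (Suc j) f = (\<lambda>x. damp j f x - rate x * damp j f x)"
    by (simp add: damp_def[abs_def] algebra_simps)
  then have "?F (Suc j) = ?F j - ip rate (damp j f)"
    using f by (simp add: ip_def)
  then have p: "ip pfun (damp j f) = 8 * (?F j - ?F (Suc j)) - 3 * ip qfun (damp j f)"
    using ip_rate[of "damp j f"] f by simp
  have "markov (damp j f) k = damp (Suc j) f k + (pfun k * ip qfun (damp j f) + qfun k * ip pfun (damp j f))"
    by (simp add: markov_def damp_def)
  then show ?thesis
    unfolding m p by (simp add: damp_centred_def dens_def algebra_simps)
qed

text \<open>Duhamel expansion: each step emits the two profiles with coefficients at most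
  \<open>L1 (damp j f)\<close>, and the orbits of these profiles have finite total norms
  \<open>Y1\<close> and \<open>Y2\<close>.\<close>

lemma sum_L1_markov_pow_damp:
  "\<exists>Y\<ge>0. \<forall>f N j. integrable torus f \<longrightarrow>
    (\<Sum>n<N. L1 ((markov ^^ n) (damp_centred j f))) \<le> Y * (\<Sum>i<N. L1 (damp (j + i) f))"
proof -
  let ?h1 = "\<lambda>k. pfun k - 3 * qfun k" and ?h2 = "\<lambda>k. dens k - markov dens k"
  define Y1 where "Y1 = (\<Sum>n. L1 ((markov ^^ n) ?h1))"
  define Y2 where "Y2 = (\<Sum>n. L1 ((markov ^^ n) ?h2))"
  have Y: "0 \<le> Y1" "0 \<le> Y2"
    unfolding Y1_def Y2_def
    by (auto intro!: suminf_nonneg summable_L1_markov_pow_pq summable_L1_markov_pow_dens L1_nonneg)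
  have Ys: "(\<Sum>n<N. L1 ((markov ^^ n) ?h1)) \<le> Y1" "(\<Sum>n<N. L1 ((markov ^^ n) ?h2)) \<le> Y2" for N
    unfolding Y1_def Y2_def
    by (auto intro!: sum_le_suminf summable_L1_markov_pow_pq summable_L1_markov_pow_dens L1_nonneg)
  have "(\<Sum>n<N. L1 ((markov ^^ n) (damp_centred j f))) \<le> (2 + Y1 + Y2) * (\<Sum>i<N. L1 (damp (j + i) f))"
    if f: "integrable torus f" for f N j
  \<comment> \<open>Splitting off the first summand shortens the sum by one and raises the damping
    index by one, hence the generalization over \<open>j\<close>.\<close>
  proof (induction N arbitrary: j)
    case (Suc N)
    define d where "d = L1 (damp j f)"
    define c where "c = ip qfun (damp j f)"
    define F where "F = (LINT x|torus. damp j f x)"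
    have c: "\<bar>c\<bar> \<le> d"
      unfolding c_def d_def using abs_ip_q_le[of "damp j f"] f by (auto intro: order_trans)
    have F: "\<bar>F\<bar> \<le> d"
      unfolding F_def d_def L1_def by (rule integral_abs_bound)
    have "L1 (damp_centred j f) \<le> \<bar>1\<bar> * L1 (damp j f) + \<bar>- F\<bar> * L1 dens"
      using L1_triangle[of "damp j f" dens 1 "- F"] f
      by (simp add: damp_centred_def[abs_def] F_def)
    \<comment> \<open>One \<open>d\<close> bounds the damped function, the other the multiple of
      \<open>dens\<close> subtracted to centre it; this is the 2 in the constant.\<close>
    then have first: "L1 (damp_centred j f) \<le> 2 * d"
      using F by (simp add: L1_dens d_def)
    have eq: "markov (damp_centred j f) =
      (\<lambda>k. 1 * (1 * damp_centred (Suc j) f k + c * ?h1 k) + F * ?h2 k)"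
      using markov_damp_centred[OF f] by (auto simp: c_def F_def)
    have step: "L1 ((markov ^^ Suc n) (damp_centred j f))
      \<le> L1 ((markov ^^ n) (damp_centred (Suc j) f)) + d * L1 ((markov ^^ n) ?h1)
        + d * L1 ((markov ^^ n) ?h2)" for n
    proof -
      have "L1 ((markov ^^ Suc n) (damp_centred j f)) = L1 ((markov ^^ n) (markov (damp_centred j f)))"
        by (simp add: funpow_swap1)
      also have "\<dots> \<le> \<bar>1\<bar> * L1 ((markov ^^ n) (\<lambda>k. 1 * damp_centred (Suc j) f k + c * ?h1 k))
          + \<bar>F\<bar> * L1 ((markov ^^ n) ?h2)"
        unfolding eq using f by (intro L1_markov_pow_lincomb_le) auto
      also have "\<dots> \<le> (\<bar>1\<bar> * L1 ((markov ^^ n) (damp_centred (Suc j) f)) + \<bar>c\<bar> * L1 ((markov ^^ n) ?h1))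
          + \<bar>F\<bar> * L1 ((markov ^^ n) ?h2)"
        using L1_markov_pow_lincomb_le[of "damp_centred (Suc j) f" ?h1 n 1 c] f by simp
      also have "\<dots> \<le> (\<bar>1\<bar> * L1 ((markov ^^ n) (damp_centred (Suc j) f)) + d * L1 ((markov ^^ n) ?h1))
          + d * L1 ((markov ^^ n) ?h2)"
        by (intro add_mono order_refl mult_right_mono c F L1_nonneg)
      finally show ?thesis by simp
    qed
    have d0: "0 \<le> d" by (simp add: d_def L1_nonneg)
    have "(\<Sum>n<Suc N. L1 ((markov ^^ n) (damp_centred j f)))
      = L1 (damp_centred j f) + (\<Sum>n<N. L1 ((markov ^^ Suc n) (damp_centred j f)))"
      by (subst sum.lessThan_Suc_shift) simp
    also have "\<dots> \<le> 2 * d + (\<Sum>n<N. L1 ((markov ^^ n) (damp_centred (Suc j) f))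
        + d * L1 ((markov ^^ n) ?h1) + d * L1 ((markov ^^ n) ?h2))"
      by (intro add_mono first sum_mono step)
    also have "\<dots> = 2 * d + (\<Sum>n<N. L1 ((markov ^^ n) (damp_centred (Suc j) f)))
        + d * (\<Sum>n<N. L1 ((markov ^^ n) ?h1)) + d * (\<Sum>n<N. L1 ((markov ^^ n) ?h2))"
      by (simp add: sum.distrib sum_distrib_left)
    also have "\<dots> \<le> 2 * d + (2 + Y1 + Y2) * (\<Sum>i<N. L1 (damp (Suc j + i) f)) + d * Y1 + d * Y2"
      by (intro add_mono order_refl Suc.IH mult_left_mono Ys d0)
    also have "\<dots> = (2 + Y1 + Y2) * (d + (\<Sum>i<N. L1 (damp (Suc j + i) f)))"
      by (simp add: algebra_simps)
    also have "d + (\<Sum>i<N. L1 (damp (Suc j + i) f)) = (\<Sum>i<Suc N. L1 (damp (j + i) f))"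
      by (subst sum.lessThan_Suc_shift) (simp add: d_def)
    finally show ?case .
  qed simp
  with Y show ?thesis by (intro exI[of _ "2 + Y1 + Y2"]) auto
qed

section \<open>Weighted decay of the powers and interpolation in the exponent\<close>

lemma AE_torus_nonzero: "AE k in torus. k \<noteq> 0 \<and> \<bar>k\<bar> \<le> 1/2"
proof -
  have "AE k in lebesgue. k \<noteq> (0::real)"
    by (intro AE_completion) (simp add: AE_lborel_singleton)
  then have "AE k in torus. k \<noteq> 0"
    unfolding torus_def by (subst AE_restrict_space_iff) auto
  moreover have "AE k in torus. \<bar>k\<bar> \<le> 1/2"
    by (rule AE_I2) (auto simp: space_torus)
  ultimately show ?thesis by eventually_elim simp
qed

text \<open>Pointwise, the geometric series sums to \<open>1 / rate k\<close>, and
  \<open>rate k\<close> is at least \<open>k^2 / 8\<close>.\<close>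

lemma sum_L1_damp_le:
  assumes f: "integrable torus f" and w: "integrable torus (\<lambda>k. \<bar>f k\<bar> / k\<^sup>2)"
  shows "(\<Sum>i<N. L1 (damp i f)) \<le> 8 * (LINT k|torus. \<bar>f k\<bar> / k\<^sup>2)"
proof -
  have "(\<Sum>i<N. L1 (damp i f)) = (LINT k|torus. (\<Sum>i<N. \<bar>damp i f k\<bar>))"
    unfolding L1_def using f by (subst Bochner_Integration.integral_sum) auto
  also have "\<dots> \<le> (LINT k|torus. 8 * (\<bar>f k\<bar> / k\<^sup>2))"
  proof (rule integral_mono_AE)
    \<comment> \<open>The bound can fail at 0, where division by zero makes the right side
      0.\<close>
    show "AE k in torus. (\<Sum>i<N. \<bar>damp i f k\<bar>) \<le> 8 * (\<bar>f k\<bar> / k\<^sup>2)"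
      using AE_torus_nonzero
    proof eventually_elim
      case (elim k)
      then have k2: "0 < k\<^sup>2" "k\<^sup>2 \<le> 8 * rate k" using rate_ge[of k] by auto
      then have r: "0 < rate k" by linarith
      have r1: "rate k < 1" using rate_le[of k] by simp
      have "(\<Sum>i<N. \<bar>damp i f k\<bar>) = (\<Sum>i<N. (1 - rate k) ^ i) * \<bar>f k\<bar>"
        using r1 by (simp add: damp_def abs_mult sum_distrib_right)
      also have "(\<Sum>i<N. (1 - rate k) ^ i) \<le> (\<Sum>i. (1 - rate k) ^ i)"
        using r r1 by (intro sum_le_suminf summable_geometric) auto
      also have "(\<Sum>i. (1 - rate k) ^ i) = 1 / rate k"
        using r r1 by (subst suminf_geometric) auto
      also have "1 / rate k \<le> 8 / k\<^sup>2" using k2 r by (simp add: field_simps)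
      finally show ?case by (simp add: mult_right_mono)
    qed
    show "integrable torus (\<lambda>k. 8 * (\<bar>f k\<bar> / k\<^sup>2))"
      by (intro integrable_mult_right w)
  qed (use f in auto)
  finally show ?thesis by (simp only: integral_mult_right_zero)
qed

text \<open>By monotonicity, \<open>Suc n\<close> times the last norm is at most the sum of the
  first \<open>Suc n\<close> norms, which the two preceding sum estimates control.\<close>

lemma L1_markov_pow_decay:
  "\<exists>C\<ge>0. \<forall>f n. integrable torus f \<longrightarrow> integrable torus (\<lambda>k. \<bar>f k\<bar> / k\<^sup>2) \<longrightarrow>
    (LINT k|torus. f k) = 0 \<longrightarrow> L1 ((markov ^^ n) f) \<le> C / real (Suc n) * (LINT k|torus. \<bar>f k\<bar> / k\<^sup>2)"
proof -
  obtain Y where Y: "0 \<le> Y" and sum: "\<And>f N j. integrable torus f \<Longrightarrow>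
    (\<Sum>n<N. L1 ((markov ^^ n) (damp_centred j f))) \<le> Y * (\<Sum>i<N. L1 (damp (j + i) f))"
    using sum_L1_markov_pow_damp by meson
  show ?thesis
  proof (intro exI[of _ "8 * Y"] conjI allI impI)
    fix f :: "real \<Rightarrow> real" and n
    assume f: "integrable torus f" and w: "integrable torus (\<lambda>k. \<bar>f k\<bar> / k\<^sup>2)"
      and mean: "(LINT k|torus. f k) = 0"
    \<comment> \<open>At index 0 there is no damping, and mean zero makes the centring correction
      vanish.\<close>
    have g0: "damp_centred 0 f = f" using mean by (simp add: damp_centred_def[abs_def] damp_def[abs_def])
    have s: "(\<Sum>m<Suc n. L1 ((markov ^^ m) f)) \<le> Y * (\<Sum>i<Suc n. L1 (damp i f))"
      using sum[OF f, where N="Suc n" and j=0] by (simp only: g0 add_0)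
    have "real (Suc n) * L1 ((markov ^^ n) f) = (\<Sum>m<Suc n. L1 ((markov ^^ n) f))" by simp
    also have "\<dots> \<le> (\<Sum>m<Suc n. L1 ((markov ^^ m) f))"
      using f by (intro sum_mono L1_markov_pow_antimono) auto
    also note s
    also have "Y * (\<Sum>i<Suc n. L1 (damp i f)) \<le> Y * (8 * (LINT k|torus. \<bar>f k\<bar> / k\<^sup>2))"
      by (intro mult_left_mono sum_L1_damp_le f w Y)
    finally show "L1 ((markov ^^ n) f) \<le> 8 * Y / real (Suc n) * (LINT k|torus. \<bar>f k\<bar> / k\<^sup>2)"
      by (simp add: field_simps)
  qed (use Y in simp)
qed

text \<open>The part of \<open>u\<close> near 0 is small in L1 and is only contracted; the rest has
  a finite \<open>1 / k^2\<close> moment and decays like \<open>1 / Suc n\<close>. The cutoff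
  parameter \<open>T\<close> is independent of \<open>n\<close>, since later \<open>n\<close> is
  averaged over a Poisson law while \<open>T\<close> stays fixed.\<close>

lemma L1_markov_pow_interpolated:
  assumes a: "0 < a" "a \<le> 1"
  shows "\<exists>C>0. \<forall>u n T. integrable torus u \<longrightarrow>
    integrable torus (\<lambda>k. \<bar>u k\<bar> / \<bar>k\<bar> powr (2 * a)) \<longrightarrow> (LINT k|torus. u k) = 0 \<longrightarrow> 1 \<le> T \<longrightarrow>
    L1 ((markov ^^ n) u) \<le> C * T powr (- a) * (T / real (Suc n) + 1)
      * (LINT k|torus. \<bar>u k\<bar> / \<bar>k\<bar> powr (2 * a))"
proof -
  obtain C where C: "0 \<le> C" and decay: "\<And>f n. integrable torus f \<Longrightarrow> integrable torus (\<lambda>k. \<bar>f k\<bar> / k\<^sup>2) \<Longrightarrow>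
    (LINT k|torus. f k) = 0 \<Longrightarrow> L1 ((markov ^^ n) f) \<le> C / real (Suc n) * (LINT k|torus. \<bar>f k\<bar> / k\<^sup>2)"
    using L1_markov_pow_decay by meson
  show ?thesis
  proof (intro exI[of _ "81 * C + 2"] conjI allI impI)
    fix u :: "real \<Rightarrow> real" and n :: nat and T :: real
    define w where "w = (\<lambda>k. \<bar>u k\<bar> / \<bar>k\<bar> powr (2 * a))"
    assume u: "integrable torus u" and "integrable torus (\<lambda>k. \<bar>u k\<bar> / \<bar>k\<bar> powr (2 * a))"
      and mean: "(LINT k|torus. u k) = 0" and T: "1 \<le> T"
    then have w: "integrable torus w" by (simp add: w_def)
    define X where "X = (LINT k|torus. w k)"
    have X: "0 \<le> X" by (simp add: X_def w_def)
    define \<delta> where "\<delta> = T powr (-1/2)"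
    have \<delta>: "0 < \<delta>" using T by (simp add: \<delta>_def)
    have \<delta>2a: "\<delta> powr (2 * a) = T powr (- a)" and \<delta>2a2: "\<delta> powr (2 * a - 2) = T * T powr (- a)"
    proof -
      show "\<delta> powr (2 * a) = T powr (- a)" by (simp add: \<delta>_def powr_powr)
      have "\<delta> powr (2 * a - 2) = T powr (1 + - a)" by (simp add: \<delta>_def powr_powr algebra_simps)
      also have "\<dots> = T * T powr (- a)" using T by (subst powr_add) auto
      finally show "\<delta> powr (2 * a - 2) = T * T powr (- a)" .
    qed
    define I where "I = (\<lambda>k. indicator {-\<delta><..<\<delta>} k :: real)"
    have I [measurable]: "I \<in> borel_measurable torus"
      unfolding I_def by (rule measurable_torus) measurable
    have I01: "I k = 0 \<or> I k = 1" for k by (auto simp: I_def indicator_def)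
    have iI: "integrable torus (\<lambda>k. I k * u k)"
      using u I01 by (intro integrable_bounded_mult[where B=1]) (auto, metis abs_one abs_zero order_refl zero_le_one)
    have small: "(LINT k|torus. \<bar>I k * u k\<bar>) \<le> T powr (- a) * X"
    proof -
      have "(LINT k|torus. \<bar>I k * u k\<bar>) \<le> (LINT k|torus. T powr (- a) * w k)"
      proof (rule integral_mono_AE)
        show "AE k in torus. \<bar>I k * u k\<bar> \<le> T powr (- a) * w k"
          using AE_torus_nonzero
        proof eventually_elim
          case (elim k)
          show ?case
          proof (cases "\<bar>k\<bar> < \<delta>")
            case True
            then have "\<bar>k\<bar> powr (2 * a) \<le> T powr (- a)"
              unfolding \<delta>2a[symmetric] using a by (intro powr_mono2) auto
            then have "\<bar>u k\<bar> * \<bar>k\<bar> powr (2 * a) \<le> \<bar>u k\<bar> * T powr (- a)" by (rule mult_left_mono) simp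
            moreover have "I k = 1" using True by (auto simp: I_def indicator_def)
            ultimately show ?thesis using elim by (simp add: field_simps w_def)
          next
            case False
            then have "I k = 0" by (auto simp: I_def indicator_def)
            then show ?thesis by (simp add: w_def)
          qed
        qed
      qed (use iI w in auto)
      then show ?thesis by (simp add: X_def)
    qed
    define m where "m = (LINT k|torus. I k * u k)"
    have m: "\<bar>m\<bar> \<le> T powr (- a) * X"
      unfolding m_def by (rule order_trans[OF integral_abs_bound small])
    \<comment> \<open>\<open>v\<close> is the near part and \<open>z\<close> the far part. Moving
      the mean \<open>m\<close> through \<open>dens\<close> gives both mean zero; the unit
      coefficients match the shape of the linear combination lemmas.\<close>
    define v where "v = (\<lambda>k. 1 * (I k * u k) + (- m) * dens k)"
    define z where "z = (\<lambda>k. 1 * u k + (- 1) * v k)"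
    have v: "integrable torus v" using iI by (simp add: v_def)
    have z: "integrable torus z" using u v by (simp add: z_def)
    have "L1 v \<le> \<bar>1\<bar> * L1 (\<lambda>k. I k * u k) + \<bar>- m\<bar> * L1 dens"
      unfolding v_def using iI by (intro L1_triangle) auto
    then have Lv: "L1 v \<le> 2 * (T powr (- a) * X)"
      using m small L1_def[of "\<lambda>k. I k * u k"] by (simp add: L1_dens)
    have "(LINT k|torus. v k) = 0" using iI by (simp add: v_def m_def integral_dens)
    then have meanz: "(LINT k|torus. z k) = 0" using u v mean by (simp add: z_def)
    have wi: "integrable torus (\<lambda>k. T * T powr (- a) * w k + 80 * \<bar>m\<bar>)" using w by auto
    \<comment> \<open>Far from 0, \<open>\<bar>k\<bar> powr (2 * a - 2)\<close> is at most its value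
      at \<open>\<delta>\<close>, the exponent being nonpositive. The 80 comes from
      \<open>dens k \<le> 80 * k^2\<close>.\<close>
    have AEz: "AE k in torus. \<bar>z k\<bar> / k\<^sup>2 \<le> T * T powr (- a) * w k + 80 * \<bar>m\<bar>"
      using AE_torus_nonzero
    proof eventually_elim
      case (elim k)
      then have k2: "0 < k\<^sup>2" by simp
      have "\<bar>z k\<bar> = \<bar>(1 - I k) * u k + m * dens k\<bar>" by (simp add: z_def v_def algebra_simps)
      also have "\<dots> \<le> (1 - I k) * \<bar>u k\<bar> + \<bar>m\<bar> * (80 * k\<^sup>2)"
        using abs_triangle_ineq[of "(1 - I k) * u k" "m * dens k"] I01[of k]
          mult_left_mono[of "dens k" "80 * k\<^sup>2" "\<bar>m\<bar>"] qfun_le_square[of k] dens_nonneg[of k]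
        by (auto simp: abs_mult dens_def)
      finally have "\<bar>z k\<bar> / k\<^sup>2 \<le> ((1 - I k) * \<bar>u k\<bar> + \<bar>m\<bar> * (80 * k\<^sup>2)) / k\<^sup>2"
        using k2 by (intro divide_right_mono) auto
      also have "\<dots> = (1 - I k) * (\<bar>u k\<bar> / k\<^sup>2) + 80 * \<bar>m\<bar>"
        using k2 by (simp add: add_divide_distrib)
      also have "(1 - I k) * (\<bar>u k\<bar> / k\<^sup>2) \<le> T * T powr (- a) * w k"
      proof (cases "\<bar>k\<bar> < \<delta>")
        case True
        then have "I k = 1" by (auto simp: I_def indicator_def)
        then show ?thesis using T by (simp add: w_def)
      next
        case False
        then have i: "I k = 0" by (auto simp: I_def indicator_def)
        have "k\<^sup>2 = \<bar>k\<bar> powr 2" using elim by (simp add: powr_numeral)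
        then have "\<bar>u k\<bar> / k\<^sup>2 = \<bar>k\<bar> powr (2 * a - 2) * w k"
          using elim by (simp add: powr_diff field_simps w_def)
        also have "\<dots> \<le> \<delta> powr (2 * a - 2) * w k"
          using False \<delta> a by (intro mult_right_mono powr_mono2') (auto simp: w_def)
        finally show ?thesis using i by (simp add: \<delta>2a2)
      qed
      finally show ?case by simp
    qed
    have zi: "integrable torus (\<lambda>k. \<bar>z k\<bar> / k\<^sup>2)"
    proof (rule Bochner_Integration.integrable_bound[OF wi])
      show "(\<lambda>k. \<bar>z k\<bar> / k\<^sup>2) \<in> borel_measurable torus"
        using borel_measurable_integrable[OF z] by measurable
      show "AE k in torus. norm (\<bar>z k\<bar> / k\<^sup>2) \<le> norm (T * T powr (- a) * w k + 80 * \<bar>m\<bar>)"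
        using AEz
      proof eventually_elim
        case (elim k)
        from order_trans[OF this abs_ge_self] show ?case by simp
      qed
    qed
    have "(LINT k|torus. \<bar>z k\<bar> / k\<^sup>2) \<le> (LINT k|torus. T * T powr (- a) * w k + 80 * \<bar>m\<bar>)"
      by (rule integral_mono_AE[OF zi wi AEz])
    also have "\<dots> = T * T powr (- a) * X + 80 * \<bar>m\<bar>"
      using w by (simp add: X_def measure_torus)
    \<comment> \<open>Here \<open>1 \<le> T\<close> lets the contribution of the mean be absorbed
      into the main term.\<close>
    also have "\<dots> \<le> T * (T powr (- a) * X) + 80 * (T * (T powr (- a) * X))"
    proof -
      have "T powr (- a) * X \<le> T * (T powr (- a) * X)"
        using T X mult_right_mono[of 1 T "T powr (- a) * X"] by simp
      with m have "80 * \<bar>m\<bar> \<le> 80 * (T * (T powr (- a) * X))" by (simp only: mult_le_cancel_left_pos order_trans)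
      then show ?thesis by (simp only: mult.assoc add_left_mono)
    qed
    finally have Z: "(LINT k|torus. \<bar>z k\<bar> / k\<^sup>2) \<le> 81 * T * (T powr (- a) * X)" by (simp add: mult_ac)
    have "u = (\<lambda>k. 1 * z k + 1 * v k)" by (simp add: z_def)
    then have "L1 ((markov ^^ n) u) \<le> \<bar>1\<bar> * L1 ((markov ^^ n) z) + \<bar>1\<bar> * L1 ((markov ^^ n) v)"
      using L1_markov_pow_lincomb_le[OF z v, of n 1 1] by simp
    also have "\<dots> \<le> C / real (Suc n) * (81 * T * (T powr (- a) * X)) + 2 * (T powr (- a) * X)"
      using decay[OF z zi meanz, of n] mult_left_mono[OF Z, of "C / real (Suc n)"] C
        L1_markov_pow_antimono[OF v, of 0 n] Lv by (auto simp del: of_nat_Suc)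
    also have "\<dots> = (81 * C) * T powr (- a) * X * (T / real (Suc n)) + 2 * (T powr (- a) * X) * 1"
      by simp
    also have "\<dots> \<le> (81 * C) * T powr (- a) * X * (T / real (Suc n) + 1)
        + 2 * (T powr (- a) * X) * (T / real (Suc n) + 1)"
      using C X T by (intro add_mono mult_left_mono mult_nonneg_nonneg) auto
    also have "\<dots> = (81 * C + 2) * T powr (- a) * (T / real (Suc n) + 1) * X"
      by (simp add: algebra_simps)
    finally show "L1 ((markov ^^ n) u) \<le> (81 * C + 2) * T powr (- a) * (T / real (Suc n) + 1)
        * (LINT k|torus. \<bar>u k\<bar> / \<bar>k\<bar> powr (2 * a))" by (simp add: X_def w_def)
  qed (use C in simp)
qed

section \<open>Poissonization\<close>

definition rgen :: "(real \<Rightarrow> real) \<Rightarrow> real \<Rightarrow> real" where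
  "rgen u k = 16 * (markov u k - u k)"

lemma integrable_rgen [simp]: "integrable torus u \<Longrightarrow> integrable torus (rgen u)"
  unfolding rgen_def[abs_def] by simp

lemma integrable_rgen_pow [simp]: "integrable torus u \<Longrightarrow> integrable torus ((rgen ^^ n) u)"
  by (induction n) auto

lemma abs_rgen_le:
  assumes "integrable torus u"
  shows "\<bar>rgen u k\<bar> \<le> 32 * \<bar>u k\<bar> + 64 * L1 u"
proof -
  have "8 * L1 u * rate k \<le> 4 * L1 u"
    using mult_left_mono[OF rate_le[of k] L1_nonneg[of u]] by (simp add: mult_ac)
  moreover have "0 \<le> rate k * \<bar>u k\<bar>" by (simp add: rate_nonneg)
  ultimately have "\<bar>markov u k\<bar> \<le> \<bar>u k\<bar> + 4 * L1 u"
    using abs_markov_le_L1[OF assms, of k] by linarith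
  then have "\<bar>markov u k - u k\<bar> \<le> 2 * \<bar>u k\<bar> + 4 * L1 u"
    using abs_triangle_ineq4[of "markov u k" "u k"] by simp
  then show ?thesis unfolding rgen_def abs_mult by simp
qed

lemma L1_rgen_le:
  assumes "integrable torus u"
  shows "L1 (rgen u) \<le> 32 * L1 u"
proof -
  have "rgen u = (\<lambda>k. 16 * markov u k + (- 16) * u k)" by (auto simp: rgen_def)
  then have "L1 (rgen u) \<le> 16 * L1 (markov u) + 16 * L1 u"
    using L1_triangle[of "markov u" u 16 "- 16"] assms by simp
  then show ?thesis using L1_markov_le[OF assms] by simp
qed

text \<open>The series defining \<open>Qsg\<close> is summed pointwise, so L1 growth alone does not
  suffice. The nonlocal part of \<open>rgen\<close> is controlled by the L1 norm, and
  \<open>32 + 64 \<le> 128\<close> closes the induction.\<close>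

lemma abs_rgen_pow_le:
  assumes "integrable torus u"
  shows "\<bar>(rgen ^^ n) u k\<bar> \<le> 128 ^ n * (\<bar>u k\<bar> + L1 u)"
proof -
  have L: "L1 ((rgen ^^ n) u) \<le> 32 ^ n * L1 u" for n
  proof (induction n)
    case (Suc n)
    show ?case using L1_rgen_le[of "(rgen ^^ n) u"] assms Suc by simp
  qed simp
  show ?thesis
  proof (induction n)
    case 0
    show ?case by (simp add: L1_nonneg)
  next
    case (Suc n)
    have "(32::real) ^ n * L1 u \<le> 128 ^ n * (\<bar>u k\<bar> + L1 u)"
      by (intro mult_mono power_mono L1_nonneg) auto
    then have "32 * \<bar>(rgen ^^ n) u k\<bar> + 64 * L1 ((rgen ^^ n) u)
      \<le> 32 * (128 ^ n * (\<bar>u k\<bar> + L1 u)) + 64 * (128 ^ n * (\<bar>u k\<bar> + L1 u))"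
      using L[of n] by (intro add_mono mult_left_mono Suc) auto
    also have "\<dots> \<le> 128 * (128 ^ n * (\<bar>u k\<bar> + L1 u))"
      by (simp add: L1_nonneg)
    finally show ?case
      using order_trans[OF abs_rgen_le[of "(rgen ^^ n) u" k]] assms by simp
  qed
qed

lemma summable_abs_rgen_series:
  assumes "integrable torus u"
  shows "summable (\<lambda>n. \<bar>t ^ n / fact n * (rgen ^^ n) u k\<bar>)"
proof (rule summable_comparison_test)
  show "summable (\<lambda>n. (128 * \<bar>t\<bar>) ^ n /\<^sub>R fact n * (\<bar>u k\<bar> + L1 u))"
    by (intro summable_mult2 summable_exp_generic)
  have "\<bar>t ^ n / fact n * (rgen ^^ n) u k\<bar> \<le> (128 * \<bar>t\<bar>) ^ n /\<^sub>R fact n * (\<bar>u k\<bar> + L1 u)" for n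
  proof -
    have "\<bar>t ^ n / fact n * (rgen ^^ n) u k\<bar> = \<bar>t\<bar> ^ n / fact n * \<bar>(rgen ^^ n) u k\<bar>"
      by (simp add: abs_mult power_abs)
    also have "\<dots> \<le> \<bar>t\<bar> ^ n / fact n * (128 ^ n * (\<bar>u k\<bar> + L1 u))"
      by (intro mult_left_mono abs_rgen_pow_le assms) auto
    finally show ?thesis by (simp add: power_mult_distrib divide_inverse mult_ac)
  qed
  then show "\<exists>N. \<forall>n\<ge>N. norm \<bar>t ^ n / fact n * (rgen ^^ n) u k\<bar> \<le> (128 * \<bar>t\<bar>) ^ n /\<^sub>R fact n * (\<bar>u k\<bar> + L1 u)"
    by auto
qed

lemma markov_sum:
  assumes "\<And>j. j \<in> J \<Longrightarrow> integrable torus (v j)" "finite J"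
  shows "markov (\<lambda>k. \<Sum>j\<in>J. c j * v j k) = (\<lambda>k. \<Sum>j\<in>J. c j * markov (v j) k)"
  using assms(2,1)
proof (induction J rule: finite_induct)
  case empty
  show ?case by (simp add: markov_def[abs_def] ip_def)
next
  case (insert i J)
  have "markov (\<lambda>k. c i * v i k + 1 * (\<Sum>j\<in>J. c j * v j k))
    = (\<lambda>k. c i * markov (v i) k + 1 * markov (\<lambda>k. \<Sum>j\<in>J. c j * v j k) k)"
    using insert by (intro markov_lincomb) auto
  then show ?case using insert by simp
qed

text \<open>\<open>markov\<close> is the identity plus \<open>rgen / 16\<close>; the induction step
  is Pascal's rule.\<close>

lemma markov_pow_binomial:
  assumes u: "integrable torus u"
  shows "(markov ^^ n) u k = (\<Sum>j\<le>n. real (n choose j) / 16 ^ j * (rgen ^^ j) u k)"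
proof (induction n arbitrary: k)
  case (Suc n)
  define x where "x j = (rgen ^^ j) u k / 16 ^ j" for j
  have step: "markov ((rgen ^^ j) u) k = (rgen ^^ j) u k + (rgen ^^ Suc j) u k / 16" for j
    by (simp add: rgen_def field_simps)
  have IH: "(markov ^^ n) u = (\<lambda>k. \<Sum>j\<le>n. real (n choose j) / 16 ^ j * (rgen ^^ j) u k)"
    using Suc by auto
  have "(markov ^^ Suc n) u k = (\<Sum>j\<le>n. real (n choose j) / 16 ^ j * markov ((rgen ^^ j) u) k)"
    unfolding funpow.simps o_apply IH using u by (subst markov_sum) auto
  also have "\<dots> = (\<Sum>j\<le>n. real (n choose j) * (x j + x (Suc j)))"
    unfolding step x_def by (intro sum.cong) (simp_all add: field_simps)
  also have "\<dots> = (\<Sum>j\<le>n. real (n choose j) * x j) + (\<Sum>j\<le>n. real (n choose j) * x (Suc j))"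
    by (simp add: distrib_left sum.distrib)
  also have "(\<Sum>j\<le>n. real (n choose j) * x j) = (\<Sum>j\<le>Suc n. real (n choose j) * x j)"
    by simp
  also have "\<dots> = x 0 + (\<Sum>j\<le>n. real (n choose Suc j) * x (Suc j))"
    by (subst sum.atMost_Suc_shift) simp
  also have "\<dots> + (\<Sum>j\<le>n. real (n choose j) * x (Suc j)) = x 0 + (\<Sum>j\<le>n. real (Suc n choose Suc j) * x (Suc j))"
    by (simp add: distrib_right sum.distrib algebra_simps)
  also have "\<dots> = (\<Sum>j\<le>Suc n. real (Suc n choose j) * x j)"
    using sum.atMost_Suc_shift[of "\<lambda>j. real (Suc n choose j) * x j" n]
    by (simp only: binomial_n_0 of_nat_1 mult_1)
  finally show ?case by (simp add: x_def del: sum.atMost_Suc)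
qed simp

text \<open>The identity \<open>exp (16 t P) = exp (16 t) * exp (t rgen)\<close>, with P for
  \<open>markov\<close>, obtained as a Cauchy product.\<close>

lemma rgen_series_eq:
  assumes u: "integrable torus u"
  shows "(\<lambda>n. (16 * t) ^ n / fact n * (markov ^^ n) u k) sums
    (exp (16 * t) * (\<Sum>n. t ^ n / fact n * (rgen ^^ n) u k))"
proof -
  let ?a = "\<lambda>n. t ^ n / fact n * (rgen ^^ n) u k" and ?b = "\<lambda>n. (16 * t) ^ n /\<^sub>R fact n"
  have "(\<lambda>n. \<Sum>i\<le>n. ?a i * ?b (n - i)) sums ((\<Sum>n. ?a n) * (\<Sum>n. ?b n))"
    using summable_abs_rgen_series[OF u, of t k] summable_norm_exp[of "16 * t"]
    by (intro Cauchy_product_sums) (simp_all del: abs_mult)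
  moreover have "(\<Sum>n. ?b n) = exp (16 * t)"
    using exp_converges[of "16 * t"] by (rule sums_unique[symmetric])
  moreover have "(\<Sum>i\<le>n. ?a i * ?b (n - i)) = (16 * t) ^ n / fact n * (markov ^^ n) u k" for n
    unfolding markov_pow_binomial[OF u] sum_distrib_left
  proof (rule sum.cong)
    fix i assume i: "i \<in> {..n}"
    then have "(16 * t) ^ n = 16 ^ i * t ^ i * (16 * t) ^ (n - i)"
      using power_add[of "16 * t" i "n - i"] by (simp add: power_mult_distrib)
    moreover have "real (n choose i) = fact n / (fact i * fact (n - i))"
      using i by (intro binomial_fact) auto
    ultimately show "?a i * ?b (n - i) = (16 * t) ^ n / fact n * (real (n choose i) / 16 ^ i * (rgen ^^ i) u k)"
      by (simp add: field_simps)
  qed simp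
  ultimately show ?thesis by (simp add: mult.commute)
qed

section \<open>Real and imaginary parts of the generator and the semigroup\<close>

lemma gen_eq:
  assumes f: "integrable torus f"
  shows "gen f = (\<lambda>k. Complex (rgen (\<lambda>k. Re (f k)) k) (rgen (\<lambda>k. Im (f k)) k))"
proof
  fix k
  have re: "integrable torus (\<lambda>k. Re (f k))" and im: "integrable torus (\<lambda>k. Im (f k))"
    using f by auto
  \<comment> \<open>Integrability is proved alongside the value because splitting the complex
    integral into its two parts requires it.\<close>
  have kernel: "(LINT k'|torus. Rker k k' * (u k' - u k)) = rgen u k"
    and kernel_int: "integrable torus (\<lambda>k'. Rker k k' * (u k' - u k))"
    if u: "integrable torus u" for u :: "real \<Rightarrow> real"
  proof -
    have eq: "Rker k k' * (u k' - u k) = 16 * pfun k * (qfun k' * u k') + 16 * qfun k * (pfun k' * u k')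
      - (16 * pfun k * u k * qfun k' + 16 * qfun k * u k * pfun k')" for k'
      by (simp add: Rker_eq algebra_simps)
    show "integrable torus (\<lambda>k'. Rker k k' * (u k' - u k))"
      unfolding eq using u by simp
    show "(LINT k'|torus. Rker k k' * (u k' - u k)) = rgen u k"
      unfolding eq using u
      by (simp add: integral_pq rgen_def markov_def rate_def flip: ip_def) (simp add: algebra_simps)
  qed
  have eq: "complex_of_real (Rker k k') * (f k' - f k) =
     of_real (Rker k k' * (Re (f k') - Re (f k))) + \<i> * of_real (Rker k k' * (Im (f k') - Im (f k)))" for k'
    by (simp add: complex_eq_iff)
  show "gen f k = Complex (rgen (\<lambda>k. Re (f k)) k) (rgen (\<lambda>k. Im (f k)) k)"
    unfolding gen_def eq using kernel_int[OF re] kernel_int[OF im]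
    by (subst Bochner_Integration.integral_add) (auto simp: kernel[OF re] kernel[OF im] complex_eq_iff integral_complex_of_real simp del: of_real_mult)
qed

lemma gen_pow_eq:
  assumes f: "integrable torus f"
  shows "(gen ^^ n) f = (\<lambda>k. Complex ((rgen ^^ n) (\<lambda>k. Re (f k)) k) ((rgen ^^ n) (\<lambda>k. Im (f k)) k))"
proof (induction n)
  case (Suc n)
  let ?g = "\<lambda>k. Complex ((rgen ^^ n) (\<lambda>k. Re (f k)) k) ((rgen ^^ n) (\<lambda>k. Im (f k)) k)"
  have "integrable torus (\<lambda>k. of_real ((rgen ^^ n) (\<lambda>k. Re (f k)) k) + \<i> * of_real ((rgen ^^ n) (\<lambda>k. Im (f k)) k))"
    using f by auto
  then have "integrable torus ?g" by (simp add: Complex_eq)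
  from gen_eq[OF this] Suc show ?case by simp
qed simp

definition rsemi :: "real \<Rightarrow> (real \<Rightarrow> real) \<Rightarrow> real \<Rightarrow> real" where
  "rsemi t u k = (\<Sum>n. t ^ n / fact n * (rgen ^^ n) u k)"

lemma Qsg_eq:
  assumes f: "integrable torus f"
  shows "Qsg t f k = Complex (rsemi t (\<lambda>k. Re (f k)) k) (rsemi t (\<lambda>k. Im (f k)) k)"
proof -
  have s: "(\<lambda>n. t ^ n / fact n * (rgen ^^ n) u k) sums rsemi t u k" if "integrable torus u" for u
    unfolding rsemi_def
    by (rule summable_sums[OF summable_rabs_cancel[OF summable_abs_rgen_series[OF that]]])
  have eq: "complex_of_real (t ^ n / fact n) * (gen ^^ n) f k =
      Complex (t ^ n / fact n * (rgen ^^ n) (\<lambda>k. Re (f k)) k) (t ^ n / fact n * (rgen ^^ n) (\<lambda>k. Im (f k)) k)" for n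
    unfolding gen_pow_eq[OF f] by (simp only: complex_of_real_mult_Complex)
  have "(\<lambda>n. complex_of_real (t ^ n / fact n) * (gen ^^ n) f k) sums
      Complex (rsemi t (\<lambda>k. Re (f k)) k) (rsemi t (\<lambda>k. Im (f k)) k)"
    unfolding eq sums_complex_iff complex.sel using f by (intro conjI s) auto
  then show ?thesis unfolding Qsg_def by (rule sums_unique[symmetric])
qed

lemma rsemi_sums:
  assumes "integrable torus u"
  shows "(\<lambda>n. exp (- (16 * t)) * ((16 * t) ^ n / fact n) * (markov ^^ n) u k) sums rsemi t u k"
proof -
  have "exp (- (16 * t)) * (exp (16 * t) * rsemi t u k) = rsemi t u k"
    by (simp add: mult.assoc[symmetric] flip: exp_add)
  with sums_mult[OF rgen_series_eq[OF assms, of t k], of "exp (- (16 * t))"]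
  show ?thesis by (simp only: mult.assoc rsemi_def)
qed

section \<open>L1 estimates for the Poisson average\<close>

lemma nn_integral_rsemi_le:
  assumes u: "integrable torus u" and t: "0 \<le> t"
    and le: "\<And>n. L1 ((markov ^^ n) u) \<le> b n"
    and b: "(\<lambda>n. (16 * t) ^ n / fact n * b n) sums B"
  shows "(\<integral>\<^sup>+ k. ennreal \<bar>rsemi t u k\<bar> \<partial>torus) \<le> ennreal (exp (- (16 * t)) * B)"
proof -
  define c where "c n = exp (- (16 * t)) * ((16 * t) ^ n / fact n)" for n
  have c: "0 \<le> c n" for n using t by (simp add: c_def)
  have cb: "(\<lambda>n. c n * b n) sums (exp (- (16 * t)) * B)"
    using sums_mult[OF b, of "exp (- (16 * t))"] by (simp add: c_def mult_ac)
  have b0: "0 \<le> b n" for n using le[of n] L1_nonneg by (rule order_trans[rotated])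
  have meas: "(\<lambda>k. ennreal \<bar>c n * (markov ^^ n) u k\<bar>) \<in> borel_measurable torus" for n
    using borel_measurable_integrable[OF markov_pow_integrable[OF u, of n]] by measurable
  \<comment> \<open>In \<open>ennreal\<close> the series and the integral can be exchanged for
    nonnegative terms without first knowing that \<open>rsemi t u\<close> is integrable.\<close>
  have "ennreal \<bar>rsemi t u k\<bar> \<le> (\<Sum>n. ennreal \<bar>c n * (markov ^^ n) u k\<bar>)" for k
  proof -
    have s: "(\<lambda>n. c n * (markov ^^ n) u k) sums rsemi t u k"
      using rsemi_sums[OF u, of t k] by (simp add: c_def)
    have lim: "(\<lambda>N. ennreal \<bar>\<Sum>n<N. c n * (markov ^^ n) u k\<bar>) \<longlonglongrightarrow> ennreal \<bar>rsemi t u k\<bar>"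
      using s unfolding sums_def by (intro tendsto_ennrealI tendsto_rabs)
    have lim': "(\<lambda>N. \<Sum>n<N. ennreal \<bar>c n * (markov ^^ n) u k\<bar>) \<longlonglongrightarrow> (\<Sum>n. ennreal \<bar>c n * (markov ^^ n) u k\<bar>)"
      by (rule summable_LIMSEQ) simp
    have "ennreal \<bar>\<Sum>n<N. c n * (markov ^^ n) u k\<bar> \<le> (\<Sum>n<N. ennreal \<bar>c n * (markov ^^ n) u k\<bar>)" for N
      by (subst sum_ennreal) (auto intro: ennreal_leI sum_abs)
    then show ?thesis by (intro LIMSEQ_le[OF lim lim']) blast
  qed
  then have "(\<integral>\<^sup>+ k. ennreal \<bar>rsemi t u k\<bar> \<partial>torus) \<le> (\<integral>\<^sup>+ k. (\<Sum>n. ennreal \<bar>c n * (markov ^^ n) u k\<bar>) \<partial>torus)"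
    by (intro nn_integral_mono)
  also have "\<dots> = (\<Sum>n. \<integral>\<^sup>+ k. ennreal \<bar>c n * (markov ^^ n) u k\<bar> \<partial>torus)"
    by (rule nn_integral_suminf[OF meas])
  also have "\<dots> = (\<Sum>n. ennreal (c n * L1 ((markov ^^ n) u)))"
  proof (rule suminf_cong)
    fix n
    show "(\<integral>\<^sup>+ k. ennreal \<bar>c n * (markov ^^ n) u k\<bar> \<partial>torus) = ennreal (c n * L1 ((markov ^^ n) u))"
      using u c[of n] by (subst nn_integral_eq_integral) (auto simp: abs_mult L1_def)
  qed
  also have "\<dots> \<le> (\<Sum>n. ennreal (c n * b n))"
    by (intro suminf_le ennreal_leI mult_left_mono le c) auto
  also have "\<dots> = ennreal (exp (- (16 * t)) * B)"
    by (rule suminf_ennreal_eq[OF _ cb]) (simp add: c b0)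
  finally show ?thesis .
qed

text \<open>Up to the factor \<open>exp (- x)\<close>, \<open>S\<close> is the mean of
  \<open>1 / (N + 1)\<close> for a Poisson variable N of mean \<open>x\<close>. Multiplication by
  \<open>x\<close> shifts the exponential series by one index, so \<open>x * S\<close> is
  \<open>exp x - 1\<close>.\<close>

lemma poisson_inverse_bound:
  assumes "0 \<le> (x::real)"
  obtains S where "(\<lambda>n. x ^ n / fact n * (1 / real (Suc n))) sums S" "(1 + x) * S \<le> 2 * exp x"
proof -
  have e: "(\<lambda>n. x ^ n / fact n) sums exp x"
    using exp_converges[of x] by (simp add: divide_inverse_commute)
  have le: "x ^ n / fact n * (1 / real (Suc n)) \<le> x ^ n / fact n" for n
    using assms mult_left_mono[of "1 / real (Suc n)" 1 "x ^ n / fact n"] by simp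
  have s: "summable (\<lambda>n. x ^ n / fact n * (1 / real (Suc n)))"
    using assms le by (intro summable_comparison_test'[OF sums_summable[OF e], of 0]) auto
  define S where "S = (\<Sum>n. x ^ n / fact n * (1 / real (Suc n)))"
  have S: "(\<lambda>n. x ^ n / fact n * (1 / real (Suc n))) sums S"
    unfolding S_def using s by (rule summable_sums)
  have "S \<le> exp x" by (rule sums_le[OF le S e])
  moreover have "x * S \<le> exp x"
  proof -
    have "(\<lambda>n. x ^ Suc n / fact (Suc n)) sums (x * S)"
      using sums_mult[OF S, of x] by (simp add: divide_inverse mult_ac)
    moreover have "(\<lambda>n. x ^ Suc n / fact (Suc n)) sums (exp x - 1)"
      using e by (subst sums_Suc_iff[of "\<lambda>n. x ^ n / fact n"]) simp
    ultimately have "x * S = exp x - 1" by (rule sums_unique2)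
    then show ?thesis by simp
  qed
  ultimately show thesis using that[OF S] by (simp add: algebra_simps)
qed

lemma measurable_rsemi:
  assumes "integrable torus u"
  shows "rsemi t u \<in> borel_measurable torus"
proof -
  have [measurable]: "(rgen ^^ n) u \<in> borel_measurable torus" for n
    using assms by (intro borel_measurable_integrable) simp
  show ?thesis unfolding rsemi_def[abs_def] by measurable
qed

text \<open>The cutoff parameter is taken as \<open>T = 1 + t\<close>. The Poisson mean of
  \<open>(1 + t) / (N + 1)\<close> is at most 2, and the constant term adds 1, whence the factor
  3.\<close>

lemma nn_integral_rsemi_decay:
  assumes a: "0 < a" "a \<le> 1"
  shows "\<exists>C>0. \<forall>u t. integrable torus u \<longrightarrow> integrable torus (\<lambda>k. \<bar>u k\<bar> / \<bar>k\<bar> powr (2 * a)) \<longrightarrow>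
    (LINT k|torus. u k) = 0 \<longrightarrow> 0 \<le> t \<longrightarrow>
    (\<integral>\<^sup>+ k. ennreal \<bar>rsemi t u k\<bar> \<partial>torus)
      \<le> ennreal (C / (1 + t) powr a * (LINT k|torus. \<bar>u k\<bar> / \<bar>k\<bar> powr (2 * a)))"
proof -
  obtain C where C: "0 < C" and decay: "\<And>u n T. integrable torus u \<Longrightarrow>
    integrable torus (\<lambda>k. \<bar>u k\<bar> / \<bar>k\<bar> powr (2 * a)) \<Longrightarrow> (LINT k|torus. u k) = 0 \<Longrightarrow> 1 \<le> T \<Longrightarrow>
    L1 ((markov ^^ n) u) \<le> C * T powr (- a) * (T / real (Suc n) + 1)
      * (LINT k|torus. \<bar>u k\<bar> / \<bar>k\<bar> powr (2 * a))"
    using L1_markov_pow_interpolated[OF a] by meson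
  show ?thesis
  proof (intro exI[of _ "3 * C"] conjI allI impI)
    fix u :: "real \<Rightarrow> real" and t :: real
    assume u: "integrable torus u" and w: "integrable torus (\<lambda>k. \<bar>u k\<bar> / \<bar>k\<bar> powr (2 * a))"
      and mean: "(LINT k|torus. u k) = 0" and t: "0 \<le> t"
    define X where "X = (LINT k|torus. \<bar>u k\<bar> / \<bar>k\<bar> powr (2 * a))"
    have X: "0 \<le> X" by (simp add: X_def)
    define A where "A = C * (1 + t) powr (- a) * X"
    have A: "0 \<le> A" using C X by (simp add: A_def)
    obtain S where S: "(\<lambda>n. (16 * t) ^ n / fact n * (1 / real (Suc n))) sums S"
      and S_le: "(1 + 16 * t) * S \<le> 2 * exp (16 * t)"
      using poisson_inverse_bound[of "16 * t"] t by auto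
    have S0: "0 \<le> S" by (rule sums_le[OF _ sums_zero S]) (use t in simp)
    have e: "(\<lambda>n. (16 * t) ^ n / fact n) sums exp (16 * t)"
      using exp_converges[of "16 * t"] by (simp add: divide_inverse_commute)
    have b: "(\<lambda>n. (16 * t) ^ n / fact n * (A * ((1 + t) / real (Suc n) + 1))) sums
        (A * ((1 + t) * S + exp (16 * t)))"
    proof -
      have "(\<lambda>n. A * ((1 + t) * ((16 * t) ^ n / fact n * (1 / real (Suc n))) + (16 * t) ^ n / fact n)) sums
        (A * ((1 + t) * S + exp (16 * t)))"
        by (intro sums_mult sums_add S e)
      moreover have eq: "A * ((1 + t) * (x * (1 / y)) + x) = x * (A * ((1 + t) / y + 1))" for x y
        by (simp add: divide_inverse algebra_simps)
      ultimately show ?thesis by (simp only: eq)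
    qed
    have le: "L1 ((markov ^^ n) u) \<le> A * ((1 + t) / real (Suc n) + 1)" for n
      using decay[OF u w mean, of "1 + t" n] t by (simp add: A_def X_def mult_ac)
    have "exp (- (16 * t)) * (A * ((1 + t) * S + exp (16 * t))) \<le> exp (- (16 * t)) * (A * (3 * exp (16 * t)))"
    proof (intro mult_left_mono A)
      have "(1 + t) * S \<le> (1 + 16 * t) * S" using t S0 by (intro mult_right_mono) auto
      with S_le show "(1 + t) * S + exp (16 * t) \<le> 3 * exp (16 * t)" by simp
    qed simp
    also have "\<dots> = 3 * C / (1 + t) powr a * X"
      by (simp add: A_def powr_minus exp_minus field_simps)
    finally show "(\<integral>\<^sup>+ k. ennreal \<bar>rsemi t u k\<bar> \<partial>torus)
      \<le> ennreal (3 * C / (1 + t) powr a * (LINT k|torus. \<bar>u k\<bar> / \<bar>k\<bar> powr (2 * a)))"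
      using nn_integral_rsemi_le[OF u t le b] unfolding X_def by (meson ennreal_leI order_trans)
  qed (use C in simp)
qed

theorem theorem6p1:
  fixes a :: real
  assumes "0 < a" and "a \<le> 1"
  shows "\<exists>C>0. \<forall>f :: real \<Rightarrow> complex.
     f \<in> borel_measurable torus \<longrightarrow>
     (\<integral>\<^sup>+ k. ennreal (norm (f k) / \<bar>k\<bar> powr (2 * a)) \<partial>torus) < \<infinity> \<longrightarrow>
     (LINT k|torus. f k) = 0 \<longrightarrow>
     (\<forall>t\<ge>0. (\<integral>\<^sup>+ k. ennreal (norm (Qsg t f k)) \<partial>torus)
        \<le> ennreal (C / (1 + t) powr a) *
          (\<integral>\<^sup>+ k. ennreal (norm (f k) / \<bar>k\<bar> powr (2 * a)) \<partial>torus))"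
proof -
  obtain C where C: "0 < C" and decay: "\<And>u t. integrable torus u \<Longrightarrow>
    integrable torus (\<lambda>k. \<bar>u k\<bar> / \<bar>k\<bar> powr (2 * a)) \<Longrightarrow> (LINT k|torus. u k) = 0 \<Longrightarrow> 0 \<le> t \<Longrightarrow>
    (\<integral>\<^sup>+ k. ennreal \<bar>rsemi t u k\<bar> \<partial>torus)
      \<le> ennreal (C / (1 + t) powr a * (LINT k|torus. \<bar>u k\<bar> / \<bar>k\<bar> powr (2 * a)))"
    using nn_integral_rsemi_decay[OF assms] by meson
  show ?thesis
  \<comment> \<open>The factor 2 pays for estimating the real and imaginary parts
    separately.\<close>
  proof (intro exI[of _ "2 * C"] conjI allI impI)
    fix f :: "real \<Rightarrow> complex" and t :: real
    assume f [measurable]: "f \<in> borel_measurable torus"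
      and fin: "(\<integral>\<^sup>+ k. ennreal (norm (f k) / \<bar>k\<bar> powr (2 * a)) \<partial>torus) < \<infinity>"
      and mean: "(LINT k|torus. f k) = 0" and t: "0 \<le> t"
    have w: "integrable torus (\<lambda>k. norm (f k) / \<bar>k\<bar> powr (2 * a))"
      using fin by (intro integrableI_nonneg) auto
    define X where "X = (LINT k|torus. norm (f k) / \<bar>k\<bar> powr (2 * a))"
    have X: "0 \<le> X" by (simp add: X_def)
    have nnX: "(\<integral>\<^sup>+ k. ennreal (norm (f k) / \<bar>k\<bar> powr (2 * a)) \<partial>torus) = ennreal X"
      unfolding X_def using w by (intro nn_integral_eq_integral) auto
    \<comment> \<open>Away from the null point 0, \<open>\<bar>k\<bar> powr (2 * a)\<close> lies in
      (0,1] on the torus, so the weighted norm dominates \<open>norm (f k)\<close>.\<close>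
    have fi: "integrable torus f"
    proof (rule Bochner_Integration.integrable_bound[OF w f])
      show "AE k in torus. norm (f k) \<le> norm (norm (f k) / \<bar>k\<bar> powr (2 * a))"
        using AE_torus_nonzero
      proof eventually_elim
        case (elim k)
        then have p: "0 < \<bar>k\<bar> powr (2 * a)" "\<bar>k\<bar> powr (2 * a) \<le> 1"
          using assms by (auto intro!: powr_le1)
        then have "norm (f k) * \<bar>k\<bar> powr (2 * a) \<le> norm (f k)" by (simp add: mult_left_le)
        with p show ?case by (simp add: pos_le_divide_eq)
      qed
    qed
    \<comment> \<open>One argument serves both \<open>Re\<close> and \<open>Im\<close>: linearity
      keeps the mean zero, and \<open>\<bar>g z\<bar> \<le> norm z\<close> keeps the weighted
      integral below \<open>X\<close>.\<close>
    have part: "(\<integral>\<^sup>+ k. ennreal \<bar>rsemi t (\<lambda>k. g (f k)) k\<bar> \<partial>torus) \<le> ennreal (C / (1 + t) powr a * X)"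
      if g: "bounded_linear g" and le: "\<And>z. \<bar>g z\<bar> \<le> norm z" for g :: "complex \<Rightarrow> real"
    proof -
      have gi: "integrable torus (\<lambda>k. g (f k))" by (rule integrable_bounded_linear[OF g fi])
      have wle: "\<bar>g (f k)\<bar> / \<bar>k\<bar> powr (2 * a) \<le> norm (f k) / \<bar>k\<bar> powr (2 * a)" for k
        by (intro divide_right_mono le) simp
      have wg: "integrable torus (\<lambda>k. \<bar>g (f k)\<bar> / \<bar>k\<bar> powr (2 * a))"
      proof (rule Bochner_Integration.integrable_bound[OF w])
        show "(\<lambda>k. \<bar>g (f k)\<bar> / \<bar>k\<bar> powr (2 * a)) \<in> borel_measurable torus"
          using borel_measurable_integrable[OF gi] by measurable
      qed (use wle in simp)
      have "(LINT k|torus. g (f k)) = 0"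
        using integral_bounded_linear[OF g fi] mean bounded_linear.linear[OF g] by (simp add: linear_0)
      from decay[OF gi wg this t] have "(\<integral>\<^sup>+ k. ennreal \<bar>rsemi t (\<lambda>k. g (f k)) k\<bar> \<partial>torus)
          \<le> ennreal (C / (1 + t) powr a * (LINT k|torus. \<bar>g (f k)\<bar> / \<bar>k\<bar> powr (2 * a)))" .
      also have "\<dots> \<le> ennreal (C / (1 + t) powr a * X)"
        unfolding X_def using C by (intro ennreal_leI mult_left_mono integral_mono w wg wle) auto
      finally show ?thesis .
    qed
    have re: "integrable torus (\<lambda>k. Re (f k))" and im: "integrable torus (\<lambda>k. Im (f k))"
      using fi by auto
    have [measurable]: "rsemi t (\<lambda>k. Re (f k)) \<in> borel_measurable torus"
      "rsemi t (\<lambda>k. Im (f k)) \<in> borel_measurable torus"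
      by (intro measurable_rsemi re im)+
    have "(\<integral>\<^sup>+ k. ennreal (norm (Qsg t f k)) \<partial>torus)
      \<le> (\<integral>\<^sup>+ k. ennreal \<bar>rsemi t (\<lambda>k. Re (f k)) k\<bar> + ennreal \<bar>rsemi t (\<lambda>k. Im (f k)) k\<bar> \<partial>torus)"
    proof (intro nn_integral_mono)
      fix k
      have "norm (Qsg t f k) \<le> \<bar>rsemi t (\<lambda>k. Re (f k)) k\<bar> + \<bar>rsemi t (\<lambda>k. Im (f k)) k\<bar>"
        using cmod_le[of "Qsg t f k"] by (simp add: Qsg_eq[OF fi])
      then show "ennreal (norm (Qsg t f k))
        \<le> ennreal \<bar>rsemi t (\<lambda>k. Re (f k)) k\<bar> + ennreal \<bar>rsemi t (\<lambda>k. Im (f k)) k\<bar>"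
        by (simp flip: ennreal_plus add: ennreal_leI)
    qed
    also have "\<dots> = (\<integral>\<^sup>+ k. ennreal \<bar>rsemi t (\<lambda>k. Re (f k)) k\<bar> \<partial>torus)
        + (\<integral>\<^sup>+ k. ennreal \<bar>rsemi t (\<lambda>k. Im (f k)) k\<bar> \<partial>torus)"
      by (intro nn_integral_add) measurable
    also have "\<dots> \<le> ennreal (C / (1 + t) powr a * X) + ennreal (C / (1 + t) powr a * X)"
      by (intro add_mono part bounded_linear_Re bounded_linear_Im abs_Re_le_cmod abs_Im_le_cmod)
    also have "\<dots> = ennreal (2 * C / (1 + t) powr a) * ennreal X"
      using C X by (simp flip: ennreal_plus ennreal_mult)
    finally show "(\<integral>\<^sup>+ k. ennreal (norm (Qsg t f k)) \<partial>torus)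
      \<le> ennreal (2 * C / (1 + t) powr a) *
          (\<integral>\<^sup>+ k. ennreal (norm (f k) / \<bar>k\<bar> powr (2 * a)) \<partial>torus)"
      unfolding nnX .
  qed (use C in simp)
qed

end
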